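(* Let $1<p<2$. Suppose $S\in L^p(\mathbb R)$ has compact support. For $\phi\in\ell_p(\mathbb Z)$ define $W_{\phi,\hat S}(\xi)=\sum_{n\in\mathbb Z}\phi(n)\hat S(\xi-n)$. Then $W_{\phi,\hat S}\in M_q(\mathbb R)$ for all $1\le q<\infty$, and $$\|W_{\phi,\hat S}\|_{M_q(\mathbb R)}\le C\,\|\phi\|_{p}\,\|S\|_{p},$$ where $C$ is a constant that does not depend on $\phi$ and depends on $S$ only through the support of $S$.
   Context: For $1\le q<\infty$, $M_q(\mathbb R)$ denotes the space of Fourier multipliers for $L^q(\mathbb R)$, i.e. functions $m\in L^\infty(\mathbb R)$ such that $f\mapsto(m\hat f)^\vee$ extends to a bounded operator on $L^q(\mathbb R)$, with $\|m\|_{M_q(\mathbb R)}$ the operator norm. Fourier transform: $\hat f(\xi)=\int_{\mathbb R}f(x)e^{-2\pi i\xi x}\,dx$. $\|\phi\|_p$ is the $\ell_p(\mathbb Z)$ norm and $\|S\|_p$ the $L^p(\mathbb R)$ norm. *)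

theory Defs
  imports "HOL-Analysis.Analysis"
begin

text \<open>Elements of \<open>L\<^sup>p\<close> are represented by functions; equality in \<open>L\<^sup>p\<close> is equality almost everywhere.
  With \<open>count_space UNIV\<close> for the measure these are the sequence spaces \<open>\<ell>\<^sub>p\<close>.\<close>

definition Lp_space :: "'a measure \<Rightarrow> real \<Rightarrow> ('a \<Rightarrow> complex) set" where
  "Lp_space M p = {f \<in> borel_measurable M. integrable M (\<lambda>x. norm (f x) powr p)}"

definition Lp_norm :: "'a measure \<Rightarrow> real \<Rightarrow> ('a \<Rightarrow> complex) \<Rightarrow> real" where
  "Lp_norm M p f = (LINT x|M. norm (f x) powr p) powr (1 / p)"

text \<open>The support of a class of functions modulo equality almost everywhere: the complement of the
  largest open set on which the function vanishes almost everywhere.\<close>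

definition ess_support :: "(real \<Rightarrow> complex) \<Rightarrow> real set" where
  "ess_support f = - \<Union>{U. open U \<and> (AE x in lebesgue. x \<in> U \<longrightarrow> f x = 0)}"

definition fourier :: "(real \<Rightarrow> complex) \<Rightarrow> real \<Rightarrow> complex" where
  "fourier f \<xi> = (LINT x|lebesgue. f x * exp (- 2 * of_real pi * \<i> * of_real \<xi> * of_real x))"

definition inv_fourier :: "(real \<Rightarrow> complex) \<Rightarrow> real \<Rightarrow> complex" where
  "inv_fourier g x = (LINT \<xi>|lebesgue. g \<xi> * exp (2 * of_real pi * \<i> * of_real x * of_real \<xi>))"

text \<open>In the next definition \<open>D n\<close> is the derivative of \<open>f\<close> of order \<open>n\<close>.\<close>

definition schwartz :: "(real \<Rightarrow> complex) set" where
  "schwartz = {f. \<exists>D :: nat \<Rightarrow> real \<Rightarrow> complex. D 0 = f \<and>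
     (\<forall>n x. (D n has_vector_derivative D (Suc n) x) (at x)) \<and>
     (\<forall>k n. bounded (range (\<lambda>x. of_real x ^ k * D n x)))}"

text \<open>\<open>T\<close> is a bounded linear operator on \<open>L\<^sup>q(\<real>)\<close> with bound \<open>B\<close>. Linearity and the bound make
  \<open>T\<close> respect equality almost everywhere.\<close>

definition bounded_Lq_operator ::
    "real \<Rightarrow> ((real \<Rightarrow> complex) \<Rightarrow> real \<Rightarrow> complex) \<Rightarrow> real \<Rightarrow> bool" where
  "bounded_Lq_operator q T B \<longleftrightarrow>
     (\<forall>f \<in> Lp_space lebesgue q. T f \<in> Lp_space lebesgue q) \<and>
     (\<forall>f \<in> Lp_space lebesgue q. \<forall>g \<in> Lp_space lebesgue q. \<forall>a b.
        AE x in lebesgue. T (\<lambda>y. a * f y + b * g y) x = a * T f x + b * T g x) \<and>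
     0 \<le> B \<and>
     (\<forall>f \<in> Lp_space lebesgue q. Lp_norm lebesgue q (T f) \<le> B * Lp_norm lebesgue q f)"

text \<open>The multiplier operator is defined first on the Schwartz class, where, for \<open>m\<close> in \<open>L\<^sup>\<infinity>\<close>, both integrals
  converge absolutely. As that class is dense in \<open>L\<^sup>q(\<real>)\<close> for finite \<open>q\<close>, a bounded extension is
  unique as an operator on \<open>L\<^sup>q(\<real>)\<close>.\<close>

definition extends_multiplier ::
    "(real \<Rightarrow> complex) \<Rightarrow> ((real \<Rightarrow> complex) \<Rightarrow> real \<Rightarrow> complex) \<Rightarrow> bool" where
  "extends_multiplier m T \<longleftrightarrow>
     (\<forall>f \<in> schwartz. AE x in lebesgue. T f x = inv_fourier (\<lambda>\<xi>. m \<xi> * fourier f \<xi>) x)"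

definition fourier_multipliers :: "real \<Rightarrow> (real \<Rightarrow> complex) set" where
  "fourier_multipliers q = {m \<in> borel_measurable lebesgue.
     (\<exists>c. AE \<xi> in lebesgue. norm (m \<xi>) \<le> c) \<and>
     (\<exists>T B. bounded_Lq_operator q T B \<and> extends_multiplier m T)}"

text \<open>The operator norm of the extension, as its least bound.\<close>

definition multiplier_norm :: "real \<Rightarrow> (real \<Rightarrow> complex) \<Rightarrow> real" where
  "multiplier_norm q m = Inf {B. \<exists>T. bounded_Lq_operator q T B \<and> extends_multiplier m T}"

definition W :: "(int \<Rightarrow> complex) \<Rightarrow> (real \<Rightarrow> complex) \<Rightarrow> real \<Rightarrow> complex" where
  "W \<phi> F \<xi> = (\<Sum>\<^sub>\<infinity>n. \<phi> n * F (\<xi> - of_int n))"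

end

(* Formally W is the Fourier transform of K = S * Phi, where Phi is the 1-periodic function with Fourier
   coefficients phi. Since p < 2, the Hausdorff-Young inequality puts Phi locally in L^p' with norm at most
   C |phi|_p, and as S has compact support, Hoelder's inequality makes K integrable with
   |K|_1 <= C |phi|_p |S|_p. Multiplication by the Fourier transform of K is convolution with K, which is
   bounded on every L^q with norm at most |K|_1; hence the bound does not depend on q. *)

theory Submission
  imports Defs "HOL-Probability.Characteristic_Functions" "HOL-Probability.Sinc_Integral"
    "HOL-Real_Asymp.Real_Asymp"
begin

section \<open>Convolution with an integrable kernel\<close>

text \<open>The function Phi is never formed. What is estimated is the product of \<open>S\<close>
  with finite trigonometric sums, uniformly over finite sets of frequencies, and K is the L^1 limit
  of such products. This one estimate serves three times: on partial sums it bounds |K|_1, on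
  differences of partial sums it gives convergence, and with the phases of the coefficients changed
  it gives absolute convergence of the series for \<open>W\<close> at every point. The last is
  needed because \<open>W\<close> is an unordered sum, which takes the value 0 by default where it
  diverges. Hausdorff-Young is needed only up to a constant, so real interpolation suffices. The
  support is enclosed in [-R, R] with R a natural number: this interval consists of whole periods of
  the exponentials, which are therefore orthogonal on it, and \<open>S\<close> enters the constant
  through R alone. The multiplier operator is prescribed only on Schwartz functions, so identifying
  it with convolution rests on Fourier inversion for them.\<close>

lemma ex_borel_representative:
  fixes f :: "real \<Rightarrow> complex"
  assumes "f \<in> borel_measurable lebesgue"
  shows "\<exists>g\<in>borel_measurable borel. AE x in lborel. f x = g x"
proof -
  have "(\<lambda>x. Re (f x)) \<in> borel_measurable lebesgue" "(\<lambda>x. Im (f x)) \<in> borel_measurable lebesgue"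
    using assms by measurable
  from this[THEN completion_ex_borel_measurable_real]
  obtain u v where [measurable]: "u \<in> borel_measurable lborel" "v \<in> borel_measurable lborel"
    and ae: "AE x in lborel. Re (f x) = u x" "AE x in lborel. Im (f x) = v x"
    by auto
  have [measurable]: "u \<in> borel_measurable borel" "v \<in> borel_measurable borel"
    using \<open>u \<in> borel_measurable lborel\<close> \<open>v \<in> borel_measurable lborel\<close> by simp_all
  have "AE x in lborel. f x = Complex (u x) (v x)"
    using ae by eventually_elim (simp add: complex_eq_iff)
  moreover have "(\<lambda>x. Complex (u x) (v x)) \<in> borel_measurable borel"
    by (subst borel_measurable_complex_iff) simp
  ultimately show ?thesis
    by (intro bexI[of _ "\<lambda>x. Complex (u x) (v x)"]) auto
qed

text \<open>The choice is made for each function, not for each class: functions equal almost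
  everywhere may receive different representatives. By \<open>convolution_cong_AE\<close> this is
  harmless for convolutions.\<close>

definition borel_rep :: "(real \<Rightarrow> complex) \<Rightarrow> real \<Rightarrow> complex" where
  "borel_rep f = (SOME g. g \<in> borel_measurable borel \<and> (AE x in lborel. f x = g x))"

lemma
  assumes "f \<in> borel_measurable lebesgue"
  shows borel_rep_measurable: "borel_rep f \<in> borel_measurable borel"
    and borel_rep_AE: "AE x in lborel. f x = borel_rep f x"
proof -
  have "\<exists>g. g \<in> borel_measurable borel \<and> (AE x in lborel. f x = g x)"
    using ex_borel_representative[OF assms] by blast
  from someI_ex[OF this] show "borel_rep f \<in> borel_measurable borel" "AE x in lborel. f x = borel_rep f x"
    unfolding borel_rep_def by blast+
qed

lemma borel_measurable_lebesgueI: "f \<in> borel_measurable borel \<Longrightarrow> f \<in> borel_measurable lebesgue"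
  by (simp add: measurable_completion)

lemma Lp_space_borel_rep:
  assumes "f \<in> Lp_space lebesgue q"
  shows "borel_rep f \<in> borel_measurable borel"
    and "AE x in lborel. f x = borel_rep f x"
    and "integrable lborel (\<lambda>x. norm (borel_rep f x) powr q)"
    and "(LINT x|lborel. norm (borel_rep f x) powr q) = (LINT x|lebesgue. norm (f x) powr q)"
proof -
  have f[measurable]: "f \<in> borel_measurable lebesgue" and i: "integrable lebesgue (\<lambda>x. norm (f x) powr q)"
    using assms by (auto simp: Lp_space_def)
  show m[measurable]: "borel_rep f \<in> borel_measurable borel" and ae: "AE x in lborel. f x = borel_rep f x"
    using borel_rep_measurable[OF f] borel_rep_AE[OF f] .
  have m'[measurable]: "borel_rep f \<in> borel_measurable lebesgue"
    using m by (rule borel_measurable_lebesgueI)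
  have ae': "AE x in lebesgue. norm (f x) powr q = norm (borel_rep f x) powr q"
    using AE_completion[OF ae] by eventually_elim simp
  have "integrable lebesgue (\<lambda>x. norm (borel_rep f x) powr q)"
    using i ae' by (subst integrable_cong_AE[symmetric]) auto
  then show "integrable lborel (\<lambda>x. norm (borel_rep f x) powr q)"
    by (subst (asm) integrable_completion) auto
  have "(LINT x|lebesgue. norm (f x) powr q) = (LINT x|lebesgue. norm (borel_rep f x) powr q)"
    using ae' by (intro integral_cong_AE) auto
  then show "(LINT x|lborel. norm (borel_rep f x) powr q) = (LINT x|lebesgue. norm (f x) powr q)"
    by (subst (asm) integral_completion) auto
qed

text \<open>Lebesgue measure is invariant under the reflection taking \<open>y\<close> to
  \<open>x - y\<close>, so the exceptional null set is carried to a null set.\<close>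

lemma AE_lborel_diff:
  fixes P :: "real \<Rightarrow> bool"
  assumes "AE y in lborel. P y"
  shows "AE y in lborel. P (x - y)"
proof -
  from AE_E[OF assms] obtain N where N: "N \<in> sets lborel" "{y. \<not> P y} \<subseteq> N" "emeasure lborel N = 0"
    by auto
  have [measurable]: "N \<in> sets borel" using N(1) by simp
  have "emeasure lborel N = (\<integral>\<^sup>+y. indicator N (x + (-1) * y) \<partial>lborel)"
    by (subst nn_integral_indicator[symmetric], simp,
        subst nn_integral_real_affine[where c="-1" and t=x]) auto
  then have "(\<integral>\<^sup>+y. indicator N (x - y) \<partial>lborel) = 0"
    using N(3) by simp
  then have "AE y in lborel. indicator N (x - y) = (0::ennreal)"
    by (subst (asm) nn_integral_0_iff_AE) auto
  then show ?thesis
    by eventually_elim (use N(2) in \<open>auto simp: indicator_def split: if_splits\<close>)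
qed

definition convolve :: "(real \<Rightarrow> complex) \<Rightarrow> (real \<Rightarrow> complex) \<Rightarrow> real \<Rightarrow> complex" where
  "convolve K f x = (LINT y|lborel. K y * f (x - y))"

text \<open>For each fixed \<open>x\<close> the integrands differ only on a reflected null set.
  Hence the equality holds at every point, and convolution depends only on the class of its second
  argument.\<close>

lemma convolution_cong_AE:
  assumes [measurable]: "K \<in> borel_measurable borel" "f \<in> borel_measurable borel" "g \<in> borel_measurable borel"
    and "AE y in lborel. f y = g y"
  shows "convolve K f = convolve K g"
proof
  fix x
  show "convolve K f x = convolve K g x"
    unfolding convolve_def using AE_lborel_diff[OF assms(4), of x]
    by (intro integral_cong_AE) auto
qed

lemma convolution_measurable:
  assumes [measurable]: "K \<in> borel_measurable borel" "f \<in> borel_measurable borel"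
  shows "convolve K f \<in> borel_measurable borel"
proof -
  have "(\<lambda>x. LINT y|lborel. K y * f (x - y)) \<in> borel_measurable borel"
    by measurable
  then show ?thesis by (simp add: convolve_def[abs_def])
qed

lemma nn_integral_convolution:
  fixes k g :: "real \<Rightarrow> ennreal"
  assumes [measurable]: "k \<in> borel_measurable borel" "g \<in> borel_measurable borel"
  shows "(\<integral>\<^sup>+x. \<integral>\<^sup>+y. k y * g (x - y) \<partial>lborel \<partial>lborel) = (\<integral>\<^sup>+y. k y \<partial>lborel) * (\<integral>\<^sup>+y. g y \<partial>lborel)"
proof -
  have shift: "(\<integral>\<^sup>+x. g (x - y) \<partial>lborel) = (\<integral>\<^sup>+y. g y \<partial>lborel)" for y
    by (subst (2) nn_integral_real_affine[where c=1 and t="-y"]) (auto simp: ac_simps)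
  have "(\<integral>\<^sup>+x. \<integral>\<^sup>+y. k y * g (x - y) \<partial>lborel \<partial>lborel) = (\<integral>\<^sup>+y. \<integral>\<^sup>+x. k y * g (x - y) \<partial>lborel \<partial>lborel)"
    by (rule lborel_pair.Fubini') measurable
  also have "\<dots> = (\<integral>\<^sup>+y. k y * (\<integral>\<^sup>+y. g y \<partial>lborel) \<partial>lborel)"
    by (intro nn_integral_cong) (simp add: nn_integral_cmult shift)
  finally show ?thesis
    by (simp add: nn_integral_multc)
qed

section \<open>Jensen's inequality for powers and Young's convolution inequality\<close>

text \<open>This is convexity of the q-th power: its graph lies above the tangent at
  \<open>c\<close>, with everything divided by \<open>q\<close>. For \<open>q > 1\<close> it is an
  instance of Young's inequality for products.\<close>

lemma powr_tangent_ineq: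
  fixes c g q :: real
  assumes "1 \<le> q" "0 < c" "0 \<le> g"
  shows "c powr (q - 1) * g \<le> g powr q / q + (1 - 1 / q) * c powr q"
proof (cases "q = 1")
  case True
  then show ?thesis using assms by auto
next
  case False
  then have q: "1 < q" using assms by simp
  have "g * c powr (q - 1) \<le> g powr q / q + (c powr (q - 1)) powr (q / (q - 1)) / (q / (q - 1))"
    by (rule Youngs_inequality) (use q assms in \<open>auto simp: field_simps\<close>)
  also have "(c powr (q - 1)) powr (q / (q - 1)) = c powr q"
    using q by (simp add: powr_powr)
  also have "c powr q / (q / (q - 1)) = (1 - 1 / q) * c powr q"
    using q by (simp add: field_simps)
  finally show ?thesis by (simp add: mult.commute)
qed

text \<open>Jensen's inequality for the measure with density \<open>k\<close>, whose mass is not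
  normalized. Integrating a tangent inequality instead of applying Hoelder's inequality treats
  \<open>q = 1\<close> and \<open>q > 1\<close> together.\<close>

lemma weighted_power_mean:
  fixes k g :: "'a \<Rightarrow> real"
  assumes q: "1 \<le> q" and [measurable]: "g \<in> borel_measurable M"
    and k: "integrable M k" and k0: "\<And>x. 0 \<le> k x" and g0: "\<And>x. 0 \<le> g x"
    and kg: "integrable M (\<lambda>x. k x * g x powr q)"
  shows "integrable M (\<lambda>x. k x * g x)"
    and "(LINT x|M. k x * g x) powr q \<le> (LINT x|M. k x) powr (q - 1) * (LINT x|M. k x * g x powr q)"
proof -
  have [measurable]: "k \<in> borel_measurable M" using k by auto
  have "g x \<le> 1 + g x powr q" for x
  proof (cases "g x \<le> 1")
    case False
    then have "g x powr 1 \<le> g x powr q" using q by (intro powr_mono) auto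
    then show ?thesis using False by simp
  qed (auto intro: add_increasing2)
  then have "k x * g x \<le> k x + k x * g x powr q" for x
    using mult_left_mono[OF _ k0[of x], of "g x" "1 + g x powr q"] by (simp add: algebra_simps)
  then show int: "integrable M (\<lambda>x. k x * g x)"
    by (intro Bochner_Integration.integrable_bound[OF Bochner_Integration.integrable_add[OF k kg]])
       (auto simp: k0 g0)
  define A where "A = (LINT x|M. k x)"
  define I where "I = (LINT x|M. k x * g x)"
  have A0: "0 \<le> A" and I0: "0 \<le> I" unfolding A_def I_def using k0 g0 by (auto intro!: integral_nonneg)
  have J0: "0 \<le> (LINT x|M. k x * g x powr q)" using k0 by (auto intro!: integral_nonneg)
  show "I powr q \<le> A powr (q - 1) * (LINT x|M. k x * g x powr q)"
  proof (cases "I = 0")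
    case True
    then show ?thesis using J0 by simp
  next
    case False
    have "A \<noteq> 0"
    proof
      assume "A = 0"
      then have "AE x in M. k x = 0"
        using integral_nonneg_eq_0_iff_AE[OF k] k0 by (auto simp: A_def)
      then have "I = (LINT x|M. 0)" unfolding I_def by (intro integral_cong_AE) auto
      then show False using False by simp
    qed
    then have A: "0 < A" and I: "0 < I" using A0 I0 False by auto
    \<comment> \<open>The weighted mean of \<open>g\<close>: the tangent taken there gives the sharp
      inequality.\<close>
    define c where "c = I / A"
    have c: "0 < c" and cA: "I = c * A" using A I by (auto simp: c_def)
    have "(LINT x|M. c powr (q - 1) * (k x * g x)) \<le>
        (LINT x|M. (k x * g x powr q) / q + ((1 - 1 / q) * c powr q) * k x)"
    proof (rule integral_mono)
      fix x
      show "c powr (q - 1) * (k x * g x) \<le> (k x * g x powr q) / q + ((1 - 1 / q) * c powr q) * k x"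
        using mult_left_mono[OF powr_tangent_ineq[OF q c g0] k0, of x x] by (simp add: algebra_simps)
    qed (use int k kg in auto)
    also have "\<dots> = (LINT x|M. k x * g x powr q) / q + ((1 - 1 / q) * c powr q) * A"
      using k kg by (simp add: A_def)
    also have "(LINT x|M. c powr (q - 1) * (k x * g x)) = c powr (q - 1) * (c * A)"
      using cA by (simp add: I_def)
    also have "\<dots> = c powr q * A"
      using c by (simp add: powr_diff)
    finally have "c powr q * A \<le> (LINT x|M. k x * g x powr q)"
      using q by (simp add: field_simps)
    then have "A powr (q - 1) * (c powr q * A) \<le> A powr (q - 1) * (LINT x|M. k x * g x powr q)"
      by (rule mult_left_mono) simp
    moreover have "A powr (q - 1) * (c powr q * A) = I powr q"
      using A c by (simp add: cA powr_mult powr_diff)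
    ultimately show ?thesis by simp
  qed
qed

text \<open>Jensen with weight \<open>norm (K y)\<close> bounds the q-th power of the convolution at
  \<open>x\<close> by \<open>A powr (q - 1)\<close> times the convolution of \<open>norm K\<close>
  with \<open>norm f powr q\<close>. Integrating over \<open>x\<close> supplies the missing factor
  \<open>A\<close>.\<close>

lemma convolution_Lq:
  assumes q: "1 \<le> q" and K: "integrable lborel K" and [measurable]: "f \<in> borel_measurable borel"
    and f: "integrable lborel (\<lambda>x. norm (f x) powr q)"
  shows "AE x in lborel. integrable lborel (\<lambda>y. K y * f (x - y))"
    and "integrable lborel (\<lambda>x. norm (convolve K f x) powr q)"
    and "(LINT x|lborel. norm (convolve K f x) powr q)
           \<le> (LINT y|lborel. norm (K y)) powr q * (LINT x|lborel. norm (f x) powr q)"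
proof -
  have [measurable]: "K \<in> borel_measurable borel" using K by auto
  note [measurable] = convolution_measurable[of K f]
  define A where "A = (LINT y|lborel. norm (K y))"
  define F where "F = (LINT x|lborel. norm (f x) powr q)"
  have A0: "0 \<le> A" "0 \<le> F" by (auto simp: A_def F_def)
  have nA: "(\<integral>\<^sup>+y. norm (K y) \<partial>lborel) = ennreal A"
    unfolding A_def using K by (intro nn_integral_eq_integral) auto
  have nF: "(\<integral>\<^sup>+y. norm (f y) powr q \<partial>lborel) = ennreal F"
    unfolding F_def using f by (intro nn_integral_eq_integral) auto
  \<comment> \<open>Finiteness of this double integral is used twice: for convergence of the
    convolution at almost every \<open>x\<close>, and for the norm estimate.\<close>
  have tot: "(\<integral>\<^sup>+x. \<integral>\<^sup>+y. norm (K y) * norm (f (x - y)) powr q \<partial>lborel \<partial>lborel) = ennreal (A * F)"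
    using nn_integral_convolution[of "\<lambda>y. ennreal (norm (K y))" "\<lambda>y. ennreal (norm (f y) powr q)"]
    by (simp add: nA nF ennreal_mult A0)
  have "AE x in lborel. (\<integral>\<^sup>+y. norm (K y) * norm (f (x - y)) powr q \<partial>lborel) \<noteq> \<infinity>"
    by (rule nn_integral_PInf_AE) (auto simp: tot)
  then have ae: "AE x in lborel. integrable lborel (\<lambda>y. norm (K y) * norm (f (x - y)) powr q)"
    by eventually_elim (auto simp: integrable_iff_bounded less_top)
  have nK: "integrable lborel (\<lambda>y. norm (K y))" using K by simp
  from ae show "AE x in lborel. integrable lborel (\<lambda>y. K y * f (x - y))"
  proof eventually_elim
    case (elim x)
    have "integrable lborel (\<lambda>y. norm (K y) * norm (f (x - y)))"
      by (rule weighted_power_mean(1)[OF q _ nK _ _ elim]) auto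
    then have "integrable lborel (\<lambda>y. norm (K y * f (x - y)))"
      by (simp add: norm_mult)
    then show ?case by (subst (asm) integrable_norm_iff) auto
  qed
  have "AE x in lborel. ennreal (norm (convolve K f x) powr q)
      \<le> ennreal (A powr (q - 1)) * (\<integral>\<^sup>+y. norm (K y) * norm (f (x - y)) powr q \<partial>lborel)"
    using ae
  proof eventually_elim
    case (elim x)
    have "norm (convolve K f x) \<le> (LINT y|lborel. norm (K y) * norm (f (x - y)))"
      unfolding convolve_def by (rule order_trans[OF integral_norm_bound]) (simp add: norm_mult)
    then have "norm (convolve K f x) powr q \<le> (LINT y|lborel. norm (K y) * norm (f (x - y))) powr q"
      using q by (intro powr_mono2) auto
    also have "\<dots> \<le> A powr (q - 1) * (LINT y|lborel. norm (K y) * norm (f (x - y)) powr q)"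
      unfolding A_def by (rule weighted_power_mean(2)[OF q _ nK _ _ elim]) auto
    finally have "ennreal (norm (convolve K f x) powr q)
        \<le> ennreal (A powr (q - 1)) * ennreal (LINT y|lborel. norm (K y) * norm (f (x - y)) powr q)"
      by (simp add: ennreal_mult[symmetric] ennreal_leI)
    also have "ennreal (LINT y|lborel. norm (K y) * norm (f (x - y)) powr q)
        = (\<integral>\<^sup>+y. norm (K y) * norm (f (x - y)) powr q \<partial>lborel)"
      using elim by (intro nn_integral_eq_integral[symmetric]) auto
    finally show ?case .
  qed
  then have "(\<integral>\<^sup>+x. norm (convolve K f x) powr q \<partial>lborel) \<le>
      (\<integral>\<^sup>+x. ennreal (A powr (q - 1)) * (\<integral>\<^sup>+y. norm (K y) * norm (f (x - y)) powr q \<partial>lborel) \<partial>lborel)"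
    by (rule nn_integral_mono_AE)
  also have "\<dots> = ennreal (A powr (q - 1)) * ennreal (A * F)"
    by (simp add: nn_integral_cmult tot)
  also have "\<dots> = ennreal (A powr q * F)"
    using A0 by (simp add: ennreal_mult[symmetric] powr_diff)
  finally have le: "(\<integral>\<^sup>+x. norm (convolve K f x) powr q \<partial>lborel) \<le> ennreal (A powr q * F)" .
  show int: "integrable lborel (\<lambda>x. norm (convolve K f x) powr q)"
    using le by (intro integrableI_bounded) (auto simp: le_less_trans[OF _ ennreal_less_top])
  show "(LINT x|lborel. norm (convolve K f x) powr q) \<le> A powr q * F"
    using le A0 by (subst (asm) nn_integral_eq_integral[OF int]) auto
qed

text \<open>Fubini needs joint measurability of \<open>(x, y) \<mapsto> f (x - y)\<close>, which may fail for a function \<open>f\<close> that is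
  only Lebesgue measurable; hence the passage to a Borel representative.\<close>

definition conv_op :: "(real \<Rightarrow> complex) \<Rightarrow> (real \<Rightarrow> complex) \<Rightarrow> real \<Rightarrow> complex" where
  "conv_op K f = convolve K (borel_rep f)"

lemma norm_add_powr_le:
  fixes a b :: complex
  assumes "0 \<le> q"
  shows "norm (a + b) powr q \<le> 2 powr q * (norm a powr q + norm b powr q)"
proof -
  have "norm (a + b) powr q \<le> (2 * max (norm a) (norm b)) powr q"
    using assms norm_triangle_ineq[of a b] by (intro powr_mono2) auto
  also have "\<dots> = 2 powr q * max (norm a) (norm b) powr q"
    by (simp add: powr_mult)
  also have "max (norm a) (norm b) powr q \<le> norm a powr q + norm b powr q"
    by (simp add: max_def)
  finally show ?thesis by simp
qed

lemma Lp_space_lincomb: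
  assumes f: "f \<in> Lp_space M q" and g: "g \<in> Lp_space M q" and q: "0 \<le> q"
  shows "(\<lambda>x. a * f x + b * g x) \<in> Lp_space M q"
proof -
  have [measurable]: "f \<in> borel_measurable M" "g \<in> borel_measurable M"
    and i: "integrable M (\<lambda>x. norm (f x) powr q)" "integrable M (\<lambda>x. norm (g x) powr q)"
    using f g by (auto simp: Lp_space_def)
  have "integrable M (\<lambda>x. norm (a * f x + b * g x) powr q)"
  proof (rule Bochner_Integration.integrable_bound)
    show "integrable M (\<lambda>x. 2 powr q * (norm a powr q * norm (f x) powr q + norm b powr q * norm (g x) powr q))"
      using i by auto
    show "AE x in M. norm (norm (a * f x + b * g x) powr q)
        \<le> norm (2 powr q * (norm a powr q * norm (f x) powr q + norm b powr q * norm (g x) powr q))"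
      using norm_add_powr_le[OF q, of "a * f _" "b * g _"] by (auto simp: norm_mult powr_mult)
  qed measurable
  then show ?thesis by (simp add: Lp_space_def)
qed

lemma bounded_Lq_operator_conv_op:
  assumes q: "1 \<le> q" and K: "integrable lborel K"
  shows "bounded_Lq_operator q (conv_op K) (LINT y|lborel. norm (K y))"
  unfolding bounded_Lq_operator_def
proof (intro conjI ballI allI)
  have [measurable]: "K \<in> borel_measurable borel" using K by auto
  fix f :: "real \<Rightarrow> complex" assume f: "f \<in> Lp_space lebesgue q"
  note rf = Lp_space_borel_rep[OF f]
  note [measurable] = rf(1)
  have m[measurable]: "conv_op K f \<in> borel_measurable borel"
    unfolding conv_op_def by (rule convolution_measurable) measurable
  note cf = convolution_Lq[OF q K rf(1) rf(3), folded conv_op_def]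
  show "conv_op K f \<in> Lp_space lebesgue q"
    using cf(2) by (auto simp: Lp_space_def integrable_completion borel_measurable_lebesgueI)
  have "Lp_norm lebesgue q (conv_op K f) = (LINT x|lborel. norm (conv_op K f x) powr q) powr (1 / q)"
    unfolding Lp_norm_def by (subst integral_completion) auto
  also have "\<dots> \<le> ((LINT y|lborel. norm (K y)) powr q * (LINT x|lborel. norm (borel_rep f x) powr q)) powr (1 / q)"
    using cf(3) q by (intro powr_mono2) auto
  also have "\<dots> = (LINT y|lborel. norm (K y)) * Lp_norm lebesgue q f"
    using q by (simp add: powr_mult powr_powr rf(4) Lp_norm_def)
  finally show "Lp_norm lebesgue q (conv_op K f) \<le> (LINT y|lborel. norm (K y)) * Lp_norm lebesgue q f" .
next
  have [measurable]: "K \<in> borel_measurable borel" using K by auto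
  fix f g :: "real \<Rightarrow> complex" and a b assume f: "f \<in> Lp_space lebesgue q" and g: "g \<in> Lp_space lebesgue q"
  define h where "h = (\<lambda>y. a * f y + b * g y)"
  have h: "h \<in> Lp_space lebesgue q"
    unfolding h_def using f g q by (intro Lp_space_lincomb) auto
  note rf = Lp_space_borel_rep[OF f] and rg = Lp_space_borel_rep[OF g] and rh = Lp_space_borel_rep[OF h]
  note [measurable] = rf(1) rg(1) rh(1)
  \<comment> \<open>The choice of representatives is not linear, but the representative of the
    combination agrees almost everywhere with the combination of the representatives.\<close>
  have "AE y in lborel. borel_rep h y = a * borel_rep f y + b * borel_rep g y"
    using rf(2) rg(2) rh(2) by eventually_elim (simp add: h_def)
  then have *: "conv_op K h = convolve K (\<lambda>y. a * borel_rep f y + b * borel_rep g y)"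
    unfolding conv_op_def by (intro convolution_cong_AE) measurable
  have "AE x in lborel. conv_op K h x = a * conv_op K f x + b * conv_op K g x"
    using convolution_Lq(1)[OF q K rf(1) rf(3)] convolution_Lq(1)[OF q K rg(1) rg(3)]
  proof eventually_elim
    case (elim x)
    have "conv_op K h x = (LINT y|lborel. a * (K y * borel_rep f (x - y)) + b * (K y * borel_rep g (x - y)))"
      unfolding * convolve_def by (simp add: algebra_simps)
    also have "\<dots> = a * conv_op K f x + b * conv_op K g x"
      using elim by (simp add: conv_op_def convolve_def)
    finally show ?case .
  qed
  then show "AE x in lebesgue. conv_op K (\<lambda>y. a * f y + b * g y) x = a * conv_op K f x + b * conv_op K g x"
    unfolding h_def by (rule AE_completion)
qed simp

section \<open>Fourier inversion for Schwartz functions\<close>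

lemma fourier_cis: "fourier f \<xi> = (LINT x|lebesgue. f x * cis (- (2 * pi * \<xi> * x)))"
  unfolding fourier_def by (simp add: cis_conv_exp algebra_simps)

lemma inv_fourier_cis: "inv_fourier g x = (LINT \<xi>|lebesgue. g \<xi> * cis (2 * pi * x * \<xi>))"
  unfolding inv_fourier_def by (simp add: cis_conv_exp algebra_simps)

lemma borel_measurable_cis[measurable (raw)]:
  "f \<in> borel_measurable M \<Longrightarrow> (\<lambda>x. cis (f x)) \<in> borel_measurable M"
  by (rule borel_measurable_continuous_onI[THEN measurable_compose[rotated]]) (auto intro: continuous_intros)

lemma fourier_lborel:
  assumes [measurable]: "f \<in> borel_measurable borel"
  shows "fourier f \<xi> = (LINT x|lborel. f x * cis (- (2 * pi * \<xi> * x)))"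
  unfolding fourier_cis by (rule integral_completion) simp

lemma inv_fourier_lborel:
  assumes [measurable]: "f \<in> borel_measurable borel"
  shows "inv_fourier f x = (LINT \<xi>|lborel. f \<xi> * cis (2 * pi * x * \<xi>))"
  unfolding inv_fourier_cis by (rule integral_completion) simp

lemma integrable_mult_cis:
  assumes "integrable M f" and [measurable]: "g \<in> borel_measurable M"
  shows "integrable M (\<lambda>x. f x * cis (g x))"
  by (rule Bochner_Integration.integrable_bound[OF assms(1)]) (use assms in \<open>auto simp: norm_mult\<close>)

lemma fourier_measurable:
  assumes [measurable]: "f \<in> borel_measurable borel"
  shows "fourier f \<in> borel_measurable borel"
proof -
  have "fourier f = (\<lambda>\<xi>. LINT x|lborel. f x * cis (- (2 * pi * \<xi> * x)))"
    by (intro ext fourier_lborel) simp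
  then show ?thesis by simp
qed

lemma norm_fourier_le:
  assumes "integrable lborel f"
  shows "norm (fourier f \<xi>) \<le> (LINT x|lborel. norm (f x))"
proof -
  have [measurable]: "f \<in> borel_measurable borel" using assms by auto
  show ?thesis
    unfolding fourier_lborel[OF \<open>f \<in> borel_measurable borel\<close>]
    by (rule order_trans[OF integral_norm_bound]) (simp add: norm_mult)
qed

section \<open>Quadratic decay and integration by parts\<close>

lemma integrable_inverse_one_plus_square: "integrable lborel (\<lambda>x::real. inverse (1 + x\<^sup>2))"
  using integrable_inverse_1_plus_square by (simp add: set_integrable_def einterval_def)

lemma integral_deriv_eq_0:
  fixes F F' :: "real \<Rightarrow> complex"
  assumes F: "\<And>x. (F has_vector_derivative F' x) (at x)" and "\<And>x. isCont F' x"
    and "integrable lborel F'" and "(F \<longlongrightarrow> 0) at_top" "(F \<longlongrightarrow> 0) at_bot"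
  shows "(LINT x|lborel. F' x) = 0"
proof -
  have "(LBINT x=-\<infinity>..\<infinity>. F' x) = 0 - 0"
    by (rule interval_integral_FTC_integrable[where F=F])
       (use assms in \<open>auto simp: ereal_tendsto_simps set_integrable_def einterval_def\<close>)
  then show ?thesis
    by (simp add: interval_lebesgue_integral_def set_lebesgue_integral_def einterval_def)
qed

text \<open>Of the Schwartz bounds only those with the powers 0 and 2 of \<open>x\<close> are used:
  quadratic decay already gives integrability and vanishing at infinity.\<close>

lemma decay_bound:
  fixes g :: "real \<Rightarrow> complex"
  assumes "bounded (range g)" "bounded (range (\<lambda>x. of_real x ^ 2 * g x))"
  obtains C where "\<And>x. norm (g x) \<le> C * inverse (1 + x\<^sup>2)"
proof -
  obtain B0 B2 where B: "\<And>x. norm (g x) \<le> B0" "\<And>x. norm (of_real x ^ 2 * g x) \<le> B2"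
    using assms unfolding bounded_iff by auto
  have "norm (g x) \<le> (B0 + B2) * inverse (1 + x\<^sup>2)" for x
  proof -
    have "norm (g x) * (1 + x\<^sup>2) \<le> B0 + B2"
      using B[of x] by (simp add: norm_mult norm_power algebra_simps)
    then show ?thesis
      by (simp add: pos_le_divide_eq add_pos_nonneg flip: divide_inverse)
  qed
  then show ?thesis by (rule that)
qed

lemma tendsto_inverse_one_plus_square:
  "((\<lambda>x::real. C * inverse (1 + x\<^sup>2)) \<longlongrightarrow> 0) at_top" "((\<lambda>x::real. C * inverse (1 + x\<^sup>2)) \<longlongrightarrow> 0) at_bot"
  by real_asymp+

lemma decay_integrable:
  fixes g :: "real \<Rightarrow> complex"
  assumes "\<And>x. norm (g x) \<le> C * inverse (1 + x\<^sup>2)" and "g \<in> borel_measurable borel"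
  shows "integrable lborel g"
  using integrable_inverse_one_plus_square
  by (intro Bochner_Integration.integrable_bound[of _ "\<lambda>x. C * inverse (1 + x\<^sup>2)" g])
     (use assms in \<open>auto intro!: order_trans[OF _ abs_ge_self] simp del: inverse_eq_divide\<close>)

lemma decay_tendsto_0:
  fixes g :: "real \<Rightarrow> complex"
  assumes "\<And>x. norm (g x) \<le> C * inverse (1 + x\<^sup>2)"
  shows "(g \<longlongrightarrow> 0) at_top" "(g \<longlongrightarrow> 0) at_bot"
  using assms by (auto intro!: tendsto_0_le[OF tendsto_inverse_one_plus_square(1)[of 1], where K=C]
      tendsto_0_le[OF tendsto_inverse_one_plus_square(2)[of 1], where K=C] always_eventually simp: mult.commute)

text \<open>Integration by parts: the derivative of \<open>g\<close> times the exponential has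
  integral zero, because the product vanishes at both ends.\<close>

lemma fourier_deriv:
  fixes g g' :: "real \<Rightarrow> complex"
  assumes g: "\<And>x. (g has_vector_derivative g' x) (at x)" and c: "\<And>x. isCont g' x"
    and b: "\<And>x. norm (g x) \<le> C * inverse (1 + x\<^sup>2)" and b': "\<And>x. norm (g' x) \<le> C' * inverse (1 + x\<^sup>2)"
  shows "fourier g' \<xi> = 2 * pi * \<i> * \<xi> * fourier g \<xi>"
proof -
  have cg: "isCont g x" for x using g has_vector_derivative_continuous by blast
  have [measurable]: "g \<in> borel_measurable borel" "g' \<in> borel_measurable borel"
    using cg c by (auto intro!: borel_measurable_continuous_onI continuous_at_imp_continuous_on)
  have ig: "integrable lborel g" "integrable lborel g'"
    by (rule decay_integrable[OF b] decay_integrable[OF b'], simp)+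
  define e where "e = (\<lambda>x. cis (- (2 * pi * \<xi> * x)))"
  define F' where "F' = (\<lambda>x. g' x * e x - 2 * pi * \<i> * \<xi> * (g x * e x))"
  have e: "(e has_vector_derivative (- (2 * pi * \<i> * \<xi>)) * e x) (at x)" for x
    unfolding e_def has_vector_derivative_def
    by (rule derivative_eq_intros refl)+ (auto simp: fun_eq_iff scaleR_conv_of_real)
  have i: "integrable lborel (\<lambda>x. g' x * e x)" "integrable lborel (\<lambda>x. g x * e x)"
    unfolding e_def using ig by (auto intro!: integrable_mult_cis)
  have "(LINT x|lborel. F' x) = 0"
  proof (rule integral_deriv_eq_0)
    show "((\<lambda>x. g x * e x) has_vector_derivative F' x) (at x)" for x
      by (rule has_vector_derivative_eq_rhs[OF has_vector_derivative_mult[OF g e]])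
         (simp add: F'_def algebra_simps)
    show "isCont F' x" for x
      unfolding F'_def e_def using c cg
      by (auto intro!: continuous_intros simp: cis_conv_exp)
    show "integrable lborel F'"
      unfolding F'_def using i by auto
    have "norm (g x * e x) \<le> C * inverse (1 + x\<^sup>2)" for x
      using b[of x] by (simp add: norm_mult e_def)
    then show "((\<lambda>x. g x * e x) \<longlongrightarrow> 0) at_top" "((\<lambda>x. g x * e x) \<longlongrightarrow> 0) at_bot"
      by (rule decay_tendsto_0)+
  qed
  then have "(LINT x|lborel. g' x * e x) = 2 * pi * \<i> * \<xi> * (LINT x|lborel. g x * e x)"
    unfolding F'_def using i by simp
  then show ?thesis
    by (simp add: fourier_lborel e_def)
qed

text \<open>The item with content is integrability of \<open>fourier f\<close>. The transform of the
  second derivative is bounded by the L^1 norm of that derivative, and it equals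
  \<open>fourier f\<close> times a quadratic factor, so \<open>fourier f\<close> decays
  quadratically.\<close>

lemma schwartz_facts:
  assumes "f \<in> schwartz"
  shows "continuous_on UNIV f" "bounded (range f)" "f \<in> borel_measurable borel"
    "integrable lborel f" "integrable lborel (fourier f)"
proof -
  obtain D where D: "D 0 = f" "\<And>n x. (D n has_vector_derivative D (Suc n) x) (at x)"
    and Db: "\<And>k n. bounded (range (\<lambda>x. of_real x ^ k * D n x))"
    using assms unfolding schwartz_def by blast
  have cont: "isCont (D n) x" for n x using D(2) has_vector_derivative_continuous by blast
  then have [measurable]: "D n \<in> borel_measurable borel" for n
    by (auto intro!: borel_measurable_continuous_onI continuous_at_imp_continuous_on)
  show "continuous_on UNIV f" using cont D(1) by (auto intro!: continuous_at_imp_continuous_on)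
  show "bounded (range f)" using Db[of 0 0] D(1) by simp
  show fm[measurable]: "f \<in> borel_measurable borel" using \<open>D 0 \<in> _\<close> D(1) by simp
  have ex: "\<exists>C. \<forall>x. norm (D n x) \<le> C * inverse (1 + x\<^sup>2)" for n
  proof -
    have "bounded (range (D n))" using Db[of 0 n] by simp
    from decay_bound[OF this Db[of 2 n]] show ?thesis by blast
  qed
  then obtain C where C: "\<And>n x. norm (D n x) \<le> C n * inverse (1 + x\<^sup>2)"
    by metis
  have int: "integrable lborel (D n)" for n
    by (rule decay_integrable[OF C]) simp
  then show "integrable lborel f" using D(1) by blast
  have fd: "fourier (D (Suc n)) \<xi> = 2 * pi * \<i> * \<xi> * fourier (D n) \<xi>" for n \<xi>
    by (rule fourier_deriv[OF D(2) cont C C])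
  have [measurable]: "fourier f \<in> borel_measurable borel"
    by (rule fourier_measurable) simp
  define B0 B2 where "B0 = (LINT x|lborel. norm (D 0 x))" and "B2 = (LINT x|lborel. norm (D 2 x))"
  have "norm (fourier f \<xi>) \<le> (B0 + B2) * inverse (1 + \<xi>\<^sup>2)" for \<xi>
  proof -
    have "norm (fourier f \<xi>) * (2 * pi * \<bar>\<xi>\<bar>)\<^sup>2 = norm (fourier (D 2) \<xi>)"
      using fd[of 1 \<xi>] fd[of 0 \<xi>] by (simp add: D(1) norm_mult numeral_2_eq_2 algebra_simps)
    also have "\<dots> \<le> B2" unfolding B2_def by (rule norm_fourier_le[OF int])
    finally have 1: "norm (fourier f \<xi>) * (2 * pi * \<bar>\<xi>\<bar>)\<^sup>2 \<le> B2" .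
    have "1 * \<bar>\<xi>\<bar> \<le> 2 * pi * \<bar>\<xi>\<bar>"
      using pi_gt3 by (intro mult_right_mono) auto
    then have "\<xi>\<^sup>2 \<le> (2 * pi * \<bar>\<xi>\<bar>)\<^sup>2"
      by (metis abs_ge_zero mult_1 power2_abs power_mono)
    then have "norm (fourier f \<xi>) * \<xi>\<^sup>2 \<le> norm (fourier f \<xi>) * (2 * pi * \<bar>\<xi>\<bar>)\<^sup>2"
      by (rule mult_left_mono) simp
    moreover have "norm (fourier f \<xi>) \<le> B0"
      using norm_fourier_le[OF int[of 0]] by (simp add: D(1) B0_def)
    ultimately have "norm (fourier f \<xi>) * (1 + \<xi>\<^sup>2) \<le> B0 + B2"
      using 1 by (simp add: algebra_simps)
    then show ?thesis
      by (simp add: pos_le_divide_eq add_pos_nonneg flip: divide_inverse)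
  qed
  then show "integrable lborel (fourier f)"
    by (rule decay_integrable) simp
qed

section \<open>Fourier inversion by Gaussian summation\<close>

lemma gaussian_fourier:
  "(LINT x|lborel. of_real (std_normal_density x) * cis (t * x)) = of_real (exp (- t\<^sup>2 / 2))"
proof -
  have "char std_normal_distribution t = (LINT x|lborel. std_normal_density x *\<^sub>R iexp (t * x))"
    unfolding char_def by (subst integral_density) auto
  then show ?thesis
    by (simp add: char_std_normal_distribution scaleR_conv_of_real cis_conv_exp)
qed

text \<open>The factor \<open>sqrt (2 * pi)\<close> normalizes the damping to have value 1 at
  \<open>\<xi> = 0\<close>. The right-hand side is the density of the centred normal distribution
  with standard deviation \<open>\<epsilon>\<close>.\<close>

lemma gaussian_fourier_scaled:
  assumes "0 < \<epsilon>"
  shows "(LINT \<xi>|lborel. of_real (sqrt (2 * pi) * std_normal_density (2 * pi * \<epsilon> * \<xi>)) * cis (2 * pi * z * \<xi>))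
    = of_real (std_normal_density (z / \<epsilon>) / \<epsilon>)"
proof -
  let ?c = "2 * pi * \<epsilon>"
  have c: "?c > 0" using assms by simp
  have "(LINT u|lborel. of_real (std_normal_density u) * cis (z / \<epsilon> * u))
     = \<bar>?c\<bar> *\<^sub>R (LINT \<xi>|lborel. of_real (std_normal_density (0 + ?c * \<xi>)) * cis (z / \<epsilon> * (0 + ?c * \<xi>)))"
    using c by (intro lborel_integral_real_affine) auto
  moreover have "z / \<epsilon> * (0 + ?c * \<xi>) = 2 * pi * z * \<xi>" for \<xi>
    using assms by (simp add: field_simps)
  ultimately have "of_real (exp (- (z / \<epsilon>)\<^sup>2 / 2)) = of_real ?c *
      (LINT \<xi>|lborel. of_real (std_normal_density (?c * \<xi>)) * cis (2 * pi * z * \<xi>))"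
    using c by (simp only: gaussian_fourier scaleR_conv_of_real abs_of_pos add_0)
  moreover have "complex_of_real ?c \<noteq> 0"
    using c by (simp only: of_real_eq_0_iff)
  moreover have "v = u / k" if "u = k * v" "k \<noteq> 0" for u v k :: complex
    using that by simp
  ultimately have *: "(LINT \<xi>|lborel. of_real (std_normal_density (?c * \<xi>)) * cis (2 * pi * z * \<xi>))
      = of_real (exp (- (z / \<epsilon>)\<^sup>2 / 2) / ?c)"
    unfolding of_real_divide by blast
  have "(LINT \<xi>|lborel. of_real (sqrt (2 * pi) * std_normal_density (?c * \<xi>)) * cis (2 * pi * z * \<xi>))
      = of_real (sqrt (2 * pi)) * (LINT \<xi>|lborel. of_real (std_normal_density (?c * \<xi>)) * cis (2 * pi * z * \<xi>))"
    by (simp add: mult.assoc)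
  also have "\<dots> = of_real (sqrt (2 * pi) * (exp (- (z / \<epsilon>)\<^sup>2 / 2) / ?c))"
    unfolding * by simp
  also have "sqrt (2 * pi) * (exp (- (z / \<epsilon>)\<^sup>2 / 2) / ?c) = std_normal_density (z / \<epsilon>) / \<epsilon>"
  proof -
    have "sqrt (2 * pi) * (exp (- (z / \<epsilon>)\<^sup>2 / 2) / ?c)
        = sqrt (2 * pi) / (2 * pi) * exp (- (z / \<epsilon>)\<^sup>2 / 2) / \<epsilon>"
      by simp
    also have "sqrt (2 * pi) / (2 * pi) = 1 / sqrt (2 * pi)"
      by (subst sqrt_divide_self_eq) (auto simp: divide_inverse)
    finally show ?thesis
      by (simp only: std_normal_density_def)
  qed
  finally show ?thesis .
qed

lemma integrable_std_normal_density: "integrable lborel std_normal_density"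
  using integrable_std_normal_moment[of 0] by simp

text \<open>Damping the inversion integral by a Gaussian turns it into the mean of \<open>f\<close> over a Gaussian of
  width \<open>\<epsilon>\<close> centred at \<open>x\<close>.\<close>

lemma fourier_gaussian_mean:
  fixes f :: "real \<Rightarrow> complex"
  assumes f: "integrable lborel f" and \<epsilon>: "0 < \<epsilon>"
  shows "(LINT \<xi>|lborel. of_real (exp (- (2 * pi * \<epsilon> * \<xi>)\<^sup>2 / 2)) * (fourier f \<xi> * cis (2 * pi * x * \<xi>)))
    = (LINT u|lborel. of_real (std_normal_density u) * f (x - \<epsilon> * u))"
proof -
  have [measurable]: "f \<in> borel_measurable borel" using f by auto
  define G where "G \<xi> = sqrt (2 * pi) * std_normal_density (2 * pi * \<epsilon> * \<xi>)" for \<xi>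
  have G: "G \<xi> = exp (- (2 * pi * \<epsilon> * \<xi>)\<^sup>2 / 2)" for \<xi>
    by (simp add: G_def std_normal_density_def)
  have G0: "0 \<le> G \<xi>" for \<xi> by (simp add: G)
  have [measurable]: "G \<in> borel_measurable borel" unfolding G_def[abs_def] by measurable
  have iG: "integrable lborel G"
    unfolding G_def[abs_def]
    using lborel_integrable_real_affine[OF integrable_std_normal_density, of "2 * pi * \<epsilon>" 0] \<epsilon> by auto
  define H where "H \<xi> y = of_real (G \<xi>) * (f y * cis (2 * pi * (x - y) * \<xi>))" for \<xi> y
  have [measurable]: "(\<lambda>(\<xi>, y). H \<xi> y) \<in> borel_measurable (lborel \<Otimes>\<^sub>M lborel)"
    unfolding H_def by measurable
  have nH: "norm (H \<xi> y) = G \<xi> * norm (f y)" for \<xi> y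
    using G0 by (simp add: H_def norm_mult)
  have iH: "integrable (lborel \<Otimes>\<^sub>M lborel) (\<lambda>(\<xi>, y). H \<xi> y)"
  proof (rule lborel_pair.Fubini_integrable)
    show "AE \<xi> in lborel. integrable lborel (\<lambda>y. case (\<xi>, y) of (\<xi>, y) \<Rightarrow> H \<xi> y)"
      unfolding H_def prod.case using f by (intro AE_I2 integrable_mult_right integrable_mult_cis) auto
    show "integrable lborel (\<lambda>\<xi>. LINT y|lborel. norm (case (\<xi>, y) of (\<xi>, y) \<Rightarrow> H \<xi> y))"
      using iG by (simp add: nH)
  qed measurable
  have "(LINT \<xi>|lborel. of_real (G \<xi>) * (fourier f \<xi> * cis (2 * pi * x * \<xi>))) = (LINT \<xi>|lborel. LINT y|lborel. H \<xi> y)"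
  proof (rule Bochner_Integration.integral_cong[OF refl])
    fix \<xi>
    have "H \<xi> y = of_real (G \<xi>) * cis (2 * pi * x * \<xi>) * (f y * cis (- (2 * pi * \<xi> * y)))" for y
    proof -
      have "cis (2 * pi * (x - y) * \<xi>) = cis (2 * pi * x * \<xi>) * cis (- (2 * pi * \<xi> * y))"
        by (simp add: cis_mult algebra_simps)
      then show ?thesis by (simp add: H_def)
    qed
    then show "of_real (G \<xi>) * (fourier f \<xi> * cis (2 * pi * x * \<xi>)) = (LINT y|lborel. H \<xi> y)"
      by (simp add: fourier_lborel)
  qed
  also have "\<dots> = (LINT y|lborel. LINT \<xi>|lborel. H \<xi> y)"
    by (rule lborel_pair.Fubini_integral[OF iH, symmetric])
  also have "\<dots> = (LINT y|lborel. f y * of_real (std_normal_density ((x - y) / \<epsilon>) / \<epsilon>))"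
  proof (rule Bochner_Integration.integral_cong[OF refl])
    fix y
    have "(LINT \<xi>|lborel. H \<xi> y) = f y * (LINT \<xi>|lborel. of_real (G \<xi>) * cis (2 * pi * (x - y) * \<xi>))"
      unfolding H_def by (subst integral_mult_right_zero[symmetric]) (simp add: algebra_simps)
    then show "(LINT \<xi>|lborel. H \<xi> y) = f y * of_real (std_normal_density ((x - y) / \<epsilon>) / \<epsilon>)"
      by (simp only: G_def gaussian_fourier_scaled[OF \<epsilon>])
  qed
  \<comment> \<open>Substitution of \<open>x - \<epsilon> * u\<close> for \<open>y\<close>; the
    Jacobian \<open>\<epsilon>\<close> cancels the factor \<open>1 / \<epsilon>\<close> of the
    density.\<close>
  also have "\<dots> = \<bar>- \<epsilon>\<bar> *\<^sub>R (LINT u|lborel. f (x + (- \<epsilon>) * u) *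
       of_real (std_normal_density ((x - (x + (- \<epsilon>) * u)) / \<epsilon>) / \<epsilon>))"
    using \<epsilon> by (intro lborel_integral_real_affine) auto
  also have "\<dots> = (LINT u|lborel. \<epsilon> *\<^sub>R (f (x - \<epsilon> * u) * of_real (std_normal_density u / \<epsilon>)))"
    using \<epsilon> by (simp only: integral_scaleR_right abs_minus) simp
  also have "\<dots> = (LINT u|lborel. of_real (std_normal_density u) * f (x - \<epsilon> * u))"
    using \<epsilon> by (intro Bochner_Integration.integral_cong) (auto simp: scaleR_conv_of_real)
  finally show ?thesis by (simp only: G)
qed

text \<open>Let the width of the Gaussian tend to 0 in \<open>fourier_gaussian_mean\<close>. The
  damped integral is dominated by \<open>norm (fourier f \<xi>)\<close>; the Gaussian mean converges
  to \<open>f x\<close> because \<open>f\<close> is bounded and continuous.\<close>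

lemma fourier_inversion:
  fixes f :: "real \<Rightarrow> complex"
  assumes c: "continuous_on UNIV f" and b: "bounded (range f)"
    and f: "integrable lborel f" and fh: "integrable lborel (fourier f)"
  shows "inv_fourier (fourier f) x = f x"
proof -
  have [measurable]: "f \<in> borel_measurable borel" "fourier f \<in> borel_measurable borel" using f fh by auto
  obtain B where B: "\<And>x. norm (f x) \<le> B" using b by (auto simp: bounded_iff)
  define \<epsilon> where "\<epsilon> k = 1 / real (Suc k)" for k
  have \<epsilon>: "0 < \<epsilon> k" for k by (simp add: \<epsilon>_def)
  have \<epsilon>0: "\<epsilon> \<longlonglongrightarrow> 0" unfolding \<epsilon>_def[abs_def] by (rule LIMSEQ_Suc[OF lim_1_over_n])
  have "(\<lambda>k. LINT \<xi>|lborel. of_real (exp (- (2 * pi * \<epsilon> k * \<xi>)\<^sup>2 / 2)) * (fourier f \<xi> * cis (2 * pi * x * \<xi>)))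
     \<longlonglongrightarrow> (LINT \<xi>|lborel. fourier f \<xi> * cis (2 * pi * x * \<xi>))"
  proof (rule integral_dominated_convergence[where w="\<lambda>\<xi>. norm (fourier f \<xi>)"])
    have "(\<lambda>k. of_real (exp (- (2 * pi * \<epsilon> k * \<xi>)\<^sup>2 / 2)) * (fourier f \<xi> * cis (2 * pi * x * \<xi>)))
      \<longlonglongrightarrow> of_real (exp (- (2 * pi * 0 * \<xi>)\<^sup>2 / 2)) * (fourier f \<xi> * cis (2 * pi * x * \<xi>))" for \<xi>
      by (intro tendsto_intros \<epsilon>0) auto
    then show "AE \<xi> in lborel. (\<lambda>k. of_real (exp (- (2 * pi * \<epsilon> k * \<xi>)\<^sup>2 / 2)) * (fourier f \<xi> * cis (2 * pi * x * \<xi>)))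
      \<longlonglongrightarrow> fourier f \<xi> * cis (2 * pi * x * \<xi>)"
      by simp
  qed (use fh in \<open>auto simp: norm_mult intro!: mult_left_le_one_le\<close>)
  moreover have "(\<lambda>k. LINT u|lborel. of_real (std_normal_density u) * f (x - \<epsilon> k * u))
     \<longlonglongrightarrow> (LINT u|lborel. of_real (std_normal_density u) * f x)"
  proof (rule integral_dominated_convergence[where w="\<lambda>u. std_normal_density u * B"])
    have "(\<lambda>k. f (x - \<epsilon> k * u)) \<longlonglongrightarrow> f (x - 0 * u)" for u
    proof (rule isCont_tendsto_compose[where g=f])
      show "isCont f (x - 0 * u)" using c continuous_on_eq_continuous_at by blast
      show "(\<lambda>k. x - \<epsilon> k * u) \<longlonglongrightarrow> x - 0 * u" by (intro tendsto_intros \<epsilon>0)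
    qed
    then show "AE u in lborel. (\<lambda>k. of_real (std_normal_density u) * f (x - \<epsilon> k * u))
      \<longlonglongrightarrow> of_real (std_normal_density u) * f x"
      by (auto intro!: tendsto_intros)
    show "integrable lborel (\<lambda>u. std_normal_density u * B)"
      using integrable_std_normal_density by simp
    show "AE u in lborel. norm (of_real (std_normal_density u) * f (x - \<epsilon> k * u)) \<le> std_normal_density u * B" for k
      using B by (auto simp: norm_mult intro!: mult_left_mono)
  qed measurable
  moreover have "(LINT u|lborel. of_real (std_normal_density u) * f x) = f x"
    using gaussian_fourier[of 0] by simp
  ultimately have "(LINT \<xi>|lborel. fourier f \<xi> * cis (2 * pi * x * \<xi>)) = f x"
    unfolding fourier_gaussian_mean[OF f \<epsilon>] by (auto intro: LIMSEQ_unique)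
  then show ?thesis by (simp add: inv_fourier_lborel)
qed

section \<open>The Hausdorff-Young inequality for trigonometric sums\<close>

definition trig_sum :: "int set \<Rightarrow> (int \<Rightarrow> complex) \<Rightarrow> real \<Rightarrow> complex" where
  "trig_sum F \<phi> x = (\<Sum>n\<in>F. \<phi> n * cis (2 * pi * of_int n * x))"

lemma trig_sum_measurable[measurable]: "trig_sum F \<phi> \<in> borel_measurable borel"
  unfolding trig_sum_def[abs_def] by measurable

lemma norm_trig_sum_le: "norm (trig_sum F \<phi> x) \<le> (\<Sum>n\<in>F. norm (\<phi> n))"
  unfolding trig_sum_def by (rule order_trans[OF norm_sum]) (simp add: norm_mult)

text \<open>Since \<open>R\<close> is a natural number, the interval consists of
  \<open>2 * R\<close> full periods, and the primitive of a nonconstant exponential takes equal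
  values at its ends.\<close>

lemma has_bochner_integral_cis:
  fixes R :: nat and a :: int
  shows "has_bochner_integral lborel (\<lambda>x. indicator {-real R..real R} x *\<^sub>R cis (2 * pi * of_int a * x))
    (if a = 0 then of_nat (2 * R) else 0)"
proof (cases "a = 0")
  case True
  have "has_bochner_integral lborel (\<lambda>x. indicator {-real R..real R} x *\<^sub>R (1::complex))
     (measure lborel {-real R..real R} *\<^sub>R 1)"
    by (rule has_bochner_integral_indicator[where c="1::complex"]) auto
  then show ?thesis using True by (simp add: scaleR_conv_of_real)
next
  case False
  define F where "F x = cis (2 * pi * of_int a * x) / (2 * pi * \<i> * of_int a)" for x
  have "has_bochner_integral lborel (\<lambda>x. indicator {-real R..real R} x *\<^sub>R cis (2 * pi * of_int a * x))
      (F (real R) - F (- real R))"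
  proof (rule has_bochner_integral_FTC_Icc)
    show "(F has_vector_derivative cis (2 * pi * of_int a * x)) (at x within {-real R..real R})" for x
      unfolding F_def has_vector_derivative_def
      by (rule derivative_eq_intros refl)+ (use False in \<open>auto simp: fun_eq_iff scaleR_conv_of_real field_simps\<close>)
  qed (auto intro!: continuous_intros)
  moreover have "cis (2 * pi * of_int a * real R) = 1" "cis (2 * pi * of_int a * - real R) = 1"
    using cis_multiple_2pi[of "of_int a * real R"] cis_multiple_2pi[of "- (of_int a * real R)"]
    by (auto simp: algebra_simps)
  then have "F (real R) - F (- real R) = 0" unfolding F_def by simp
  ultimately show ?thesis using False by simp
qed

text \<open>After expanding the square as a double sum, orthogonality leaves only the diagonal
  terms.\<close>

lemma parseval_finite:
  fixes R :: nat
  assumes F: "finite F"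
  shows "(\<integral>\<^sup>+x. indicator {-real R..real R} x * ennreal ((norm (trig_sum F \<phi> x))\<^sup>2) \<partial>lborel)
    = ennreal (2 * R * (\<Sum>n\<in>F. (norm (\<phi> n))\<^sup>2))"
proof -
  let ?I = "{-real R..real R}"
  have "has_bochner_integral lborel (\<lambda>x. \<Sum>n\<in>F. \<Sum>m\<in>F. (\<phi> n * cnj (\<phi> m)) *
       (indicator ?I x *\<^sub>R cis (2 * pi * of_int (n - m) * x)))
     (\<Sum>n\<in>F. \<Sum>m\<in>F. (\<phi> n * cnj (\<phi> m)) * (if n - m = 0 then of_nat (2 * R) else 0))"
    by (intro has_bochner_integral_sum has_bochner_integral_mult_right has_bochner_integral_cis)
  also have "(\<lambda>x. \<Sum>n\<in>F. \<Sum>m\<in>F. (\<phi> n * cnj (\<phi> m)) * (indicator ?I x *\<^sub>R cis (2 * pi * of_int (n - m) * x)))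
      = (\<lambda>x. complex_of_real (indicator ?I x * (norm (trig_sum F \<phi> x))\<^sup>2))"
  proof
    fix x
    have "complex_of_real ((norm (trig_sum F \<phi> x))\<^sup>2) = trig_sum F \<phi> x * cnj (trig_sum F \<phi> x)"
      by (rule complex_norm_square)
    also have "\<dots> = (\<Sum>n\<in>F. \<Sum>m\<in>F. (\<phi> n * cis (2 * pi * of_int n * x)) * (cnj (\<phi> m) * cis (- (2 * pi * of_int m * x))))"
      unfolding trig_sum_def by (simp add: sum_product cis_cnj)
    also have "\<dots> = (\<Sum>n\<in>F. \<Sum>m\<in>F. (\<phi> n * cnj (\<phi> m)) * cis (2 * pi * of_int (n - m) * x))"
    proof (intro sum.cong refl)
      fix n m :: int
      have "cis (2 * pi * of_int (n - m) * x) = cis (2 * pi * of_int n * x) * cis (- (2 * pi * of_int m * x))"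
        by (simp add: cis_mult algebra_simps)
      then show "(\<phi> n * cis (2 * pi * of_int n * x)) * (cnj (\<phi> m) * cis (- (2 * pi * of_int m * x)))
          = (\<phi> n * cnj (\<phi> m)) * cis (2 * pi * of_int (n - m) * x)"
        by simp
    qed
    finally show "(\<Sum>n\<in>F. \<Sum>m\<in>F. (\<phi> n * cnj (\<phi> m)) * (indicator ?I x *\<^sub>R cis (2 * pi * of_int (n - m) * x)))
      = complex_of_real (indicator ?I x * (norm (trig_sum F \<phi> x))\<^sup>2)"
      by (simp add: scaleR_conv_of_real sum_distrib_left mult_ac)
  qed
  also have "(\<Sum>n\<in>F. \<Sum>m\<in>F. (\<phi> n * cnj (\<phi> m)) * (if n - m = 0 then of_nat (2 * R) else 0))
      = (\<Sum>n\<in>F. \<Sum>m\<in>F. if m = n then of_real ((norm (\<phi> n))\<^sup>2) * of_nat (2 * R) else 0)"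
    by (intro sum.cong refl) (auto simp: complex_norm_square simp del: of_real_power)
  also have "\<dots> = complex_of_real (2 * R * (\<Sum>n\<in>F. (norm (\<phi> n))\<^sup>2))"
    using F by (simp add: sum.delta sum_distrib_left mult_ac)
  finally have "has_bochner_integral lborel (\<lambda>x. indicator ?I x * (norm (trig_sum F \<phi> x))\<^sup>2)
      (2 * R * (\<Sum>n\<in>F. (norm (\<phi> n))\<^sup>2))"
    using has_bochner_integral_bounded_linear[OF bounded_linear_Re] by fastforce
  then have "(\<integral>\<^sup>+x. ennreal (indicator ?I x * (norm (trig_sum F \<phi> x))\<^sup>2) \<partial>lborel)
      = ennreal (2 * R * (\<Sum>n\<in>F. (norm (\<phi> n))\<^sup>2))"
    by (subst nn_integral_eq_integral) (auto simp: has_bochner_integral_iff)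
  then show ?thesis
    by (simp add: ennreal_mult' ennreal_indicator)
qed

text \<open>Used with the exponents \<open>q - 1\<close> and \<open>q - 3\<close>. For the second,
  integrability at 0 means exactly \<open>q > 2\<close>, that is \<open>p < 2\<close>.\<close>

lemma nn_integral_powr_from_0:
  fixes s b :: real
  assumes "s > -1" "b \<ge> 0"
  shows "(\<integral>\<^sup>+x. ennreal (indicator {0..b} x * x powr s) \<partial>lborel) = ennreal (b powr (s + 1) / (s + 1))"
proof (rule nn_integral_has_integral_lborel)
  have "((\<lambda>x. x powr s) has_integral (b powr (s + 1) / (s + 1))) {0..b}"
    using assms by (rule has_integral_powr_from_0)
  then show "((\<lambda>x. indicator {0..b} x * x powr s) has_integral (b powr (s + 1) / (s + 1))) UNIV"
    by (subst (asm) has_integral_restrict_UNIV[symmetric])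
       (auto simp: indicator_def of_bool_def if_distrib[of "\<lambda>x. x * _"] cong: if_cong)
qed auto

text \<open>The factor \<open>q\<close> comes from the layer-cake formula, 4 from squaring
  \<open>l/2\<close>, 2 from the interval length \<open>2 * R\<close> in Parseval, and the rest from
  integrating \<open>l powr (q - 3)\<close> up to the truncation level. It blows up as
  \<open>q\<close> tends to 2, which is harmless for fixed \<open>p < 2\<close>.\<close>

definition hy_const :: "real \<Rightarrow> real" where
  "hy_const q = 8 * q * 2 powr (q - 2) / (q - 2)"

text \<open>Marcinkiewicz interpolation between \<open>\<ell>\<^sub>1 \<rightarrow> L\<^sup>\<infinity>\<close> and \<open>\<ell>\<^sub>2 \<rightarrow> L\<^sup>2\<close>: at level \<open>l\<close> split \<open>\<phi>\<close> at height
  \<open>(l/2) powr (-1/(p - 1))\<close>. The part above this height contributes at most \<open>l/2\<close> to the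
  trigonometric sum, so where the sum exceeds \<open>l\<close> the part below contributes at least \<open>l/2\<close>.\<close>

lemma hausdorff_young_normalized:
  fixes R :: nat
  assumes p: "1 < p" "p < 2" and q: "q = p / (p - 1)" and F: "finite F"
    and le1: "(\<Sum>n\<in>F. norm (\<phi> n) powr p) \<le> 1"
  shows "(\<integral>\<^sup>+x. indicator {-real R..real R} x * ennreal (norm (trig_sum F \<phi> x) powr q) \<partial>lborel)
    \<le> ennreal (hy_const q * R)"
proof -
  let ?I = "{-real R..real R}"
  have q2: "q > 2" using p by (simp add: q field_simps)
  \<comment> \<open>The comparison with the height is multiplied out, so that no division by
    \<open>l\<close> or by a vanishing coefficient occurs.\<close>
  define sm where "sm l n = (if l * norm (\<phi> n) powr (p - 1) \<le> 2 then \<phi> n else 0)" for l n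
  define bg where "bg l n = (if l * norm (\<phi> n) powr (p - 1) \<le> 2 then 0 else \<phi> n)" for l n
  have split: "trig_sum F \<phi> x = trig_sum F (sm l) x + trig_sum F (bg l) x" for l x
    unfolding trig_sum_def sum.distrib[symmetric] by (intro sum.cong) (auto simp: sm_def bg_def)
  have big: "norm (trig_sum F (bg l) x) \<le> l / 2" if l: "0 < l" for l x
  proof -
    \<comment> \<open>For a coefficient above the height, multiplying
      \<open>2 < l * norm (\<phi> n) powr (p - 1)\<close> by \<open>norm (\<phi> n)\<close> trades
      its modulus for its p-th power, whose sum is at most 1.\<close>
    have "norm (bg l n) \<le> l / 2 * norm (\<phi> n) powr p" for n
    proof (cases "l * norm (\<phi> n) powr (p - 1) \<le> 2")
      case False
      then have "norm (\<phi> n) * 2 \<le> norm (\<phi> n) * (l * norm (\<phi> n) powr (p - 1))"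
        by (intro mult_left_mono) auto
      also have "\<dots> = l * norm (\<phi> n) powr p"
        by (cases "\<phi> n = 0") (simp_all add: powr_diff)
      finally show ?thesis using False by (simp add: bg_def)
    qed (use l in \<open>simp add: bg_def\<close>)
    then have "(\<Sum>n\<in>F. norm (bg l n)) \<le> l / 2 * (\<Sum>n\<in>F. norm (\<phi> n) powr p)"
      unfolding sum_distrib_left by (rule sum_mono)
    also have "\<dots> \<le> l / 2 * 1" using le1 l by (intro mult_left_mono) auto
    finally show ?thesis using norm_trig_sum_le[of F "bg l" x] by simp
  qed
  \<comment> \<open>The layer-cake formula writes \<open>y powr q\<close> as the integral of
    \<open>q * l powr (q - 1)\<close> over \<open>0 < l \<le> y\<close>. There the small part has
    modulus z with \<open>l / 2 \<le> z\<close>, so two of the powers of \<open>l\<close> can be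
    replaced by \<open>4 * z\<^sup>2\<close>. The resulting \<open>h\<close> is quadratic in the
    small part, as Parseval requires.\<close>
  define h where "h l x = 4 * q * (l powr (q - 3) * (norm (trig_sum F (sm l) x))\<^sup>2)" for l x
  have h0: "0 \<le> h l x" for l x using q2 by (simp add: h_def)
  have hm[measurable]: "(\<lambda>(x, l). h l x) \<in> borel_measurable (lborel \<Otimes>\<^sub>M lborel)"
    unfolding h_def trig_sum_def sm_def by measurable
  have pt: "ennreal (norm (trig_sum F \<phi> x) powr q) \<le> (\<integral>\<^sup>+l. indicator {0..} l * ennreal (h l x) \<partial>lborel)" for x
  proof -
    define y where "y = norm (trig_sum F \<phi> x)"
    have y0: "0 \<le> y" by (simp add: y_def)
    have "ennreal (y powr q) = ennreal q * ennreal (y powr (q - 1 + 1) / (q - 1 + 1))"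
      using q2 by (simp add: ennreal_mult[symmetric])
    also have "\<dots> = ennreal q * (\<integral>\<^sup>+l. ennreal (indicator {0..y} l * l powr (q - 1)) \<partial>lborel)"
      using q2 y0 by (subst nn_integral_powr_from_0) auto
    also have "\<dots> = (\<integral>\<^sup>+l. ennreal q * ennreal (indicator {0..y} l * l powr (q - 1)) \<partial>lborel)"
      by (simp add: nn_integral_cmult)
    also have "\<dots> \<le> (\<integral>\<^sup>+l. indicator {0..} l * ennreal (h l x) \<partial>lborel)"
    proof (rule nn_integral_mono)
      fix l :: real
      show "ennreal q * ennreal (indicator {0..y} l * l powr (q - 1)) \<le> indicator {0..} l * ennreal (h l x)"
      proof (cases "0 < l \<and> l \<le> y")
        case True
        define z where "z = norm (trig_sum F (sm l) x)"
        have "y \<le> z + l / 2"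
          unfolding y_def z_def split[of x l] using True big[of l x] norm_triangle_ineq by (smt (verit))
        then have "l / 2 \<le> z" using True by simp
        then have "(l / 2)\<^sup>2 \<le> z\<^sup>2" using True by (intro power_mono) auto
        then have "l powr (q - 3) * l\<^sup>2 \<le> l powr (q - 3) * (4 * z\<^sup>2)"
          by (intro mult_left_mono) (auto simp: power_divide)
        moreover have "l powr (q - 3) * l\<^sup>2 = l powr (q - 1)"
          using True by (simp add: powr_add[symmetric] flip: powr_numeral)
        ultimately have "q * l powr (q - 1) \<le> q * (l powr (q - 3) * (4 * z\<^sup>2))"
          using q2 by (intro mult_left_mono) auto
        then have "q * l powr (q - 1) \<le> h l x"
          by (simp add: h_def z_def algebra_simps)
        then show ?thesis
          using True q2 by (simp add: ennreal_mult[symmetric] ennreal_leI)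
      qed (auto simp: indicator_def)
    qed
    finally show ?thesis by (simp add: y_def)
  qed
  have inner: "(\<integral>\<^sup>+x. indicator ?I x * ennreal (h l x) \<partial>lborel)
      = ennreal (8 * q * R) * (\<Sum>n\<in>F. ennreal (l powr (q - 3) * (norm (sm l n))\<^sup>2))" for l
  proof -
    have "(\<integral>\<^sup>+x. indicator ?I x * ennreal (h l x) \<partial>lborel)
       = (\<integral>\<^sup>+x. ennreal (4 * q * l powr (q - 3)) * (indicator ?I x * ennreal ((norm (trig_sum F (sm l) x))\<^sup>2)) \<partial>lborel)"
      using q2 by (intro nn_integral_cong) (simp add: h_def ennreal_mult mult_ac)
    also have "\<dots> = ennreal (4 * q * l powr (q - 3)) * ennreal (2 * R * (\<Sum>n\<in>F. (norm (sm l n))\<^sup>2))"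
      using F by (subst nn_integral_cmult) (auto simp: parseval_finite)
    also have "\<dots> = ennreal (8 * q * R * (\<Sum>n\<in>F. l powr (q - 3) * (norm (sm l n))\<^sup>2))"
      using q2 by (subst ennreal_mult[symmetric])
        (auto intro!: sum_nonneg mult_nonneg_nonneg simp: sum_distrib_left mult_ac)
    also have "\<dots> = ennreal (8 * q * R) * (\<Sum>n\<in>F. ennreal (l powr (q - 3) * (norm (sm l n))\<^sup>2))"
      using q2 by (subst ennreal_mult) (auto intro!: sum_nonneg)
    finally show ?thesis .
  qed
  \<comment> \<open>For \<open>l \<ge> 0\<close>, a nonzero coefficient of modulus \<open>w\<close>
    belongs to the small part exactly up to \<open>l = 2 * w powr (1 - p)\<close>. Integrating
    \<open>l powr (q - 3)\<close> to this point gives the power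
    \<open>(1 - p) * (q - 2) = p - 2\<close> of \<open>w\<close>, by conjugacy of \<open>p\<close>
    and \<open>q\<close>; the factor \<open>w\<^sup>2\<close> raises it to
    \<open>w powr p\<close>.\<close>
  have layer: "(\<integral>\<^sup>+l. indicator {0..} l * ennreal (l powr (q - 3) * (norm (sm l n))\<^sup>2) \<partial>lborel)
      = ennreal (2 powr (q - 2) / (q - 2) * norm (\<phi> n) powr p)" for n
  proof (cases "\<phi> n = 0")
    case False
    define w where "w = norm (\<phi> n)"
    define b where "b = 2 * w powr (1 - p)"
    have w: "0 < w" using False by (simp add: w_def)
    have b0: "0 \<le> b" by (simp add: b_def)
    have iff: "l * w powr (p - 1) \<le> 2 \<longleftrightarrow> l \<le> b" for l
    proof -
      have "w powr (1 - p) * w powr (p - 1) = 1" using w by (simp add: powr_add[symmetric])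
      then have "b * w powr (p - 1) = 2" by (simp add: b_def)
      then have "l * w powr (p - 1) \<le> 2 \<longleftrightarrow> l * w powr (p - 1) \<le> b * w powr (p - 1)" by simp
      also have "\<dots> \<longleftrightarrow> l \<le> b" using w by simp
      finally show ?thesis .
    qed
    have "(\<integral>\<^sup>+l. indicator {0..} l * ennreal (l powr (q - 3) * (norm (sm l n))\<^sup>2) \<partial>lborel)
       = (\<integral>\<^sup>+l. ennreal (w\<^sup>2) * ennreal (indicator {0..b} l * l powr (q - 3)) \<partial>lborel)"
      by (intro nn_integral_cong)
         (auto simp: sm_def iff indicator_def ennreal_mult[symmetric] mult_ac simp flip: w_def)
    also have "\<dots> = ennreal (w\<^sup>2) * ennreal (b powr (q - 3 + 1) / (q - 3 + 1))"
      using q2 b0 by (subst nn_integral_cmult, simp, subst nn_integral_powr_from_0) auto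
    also have "\<dots> = ennreal (w\<^sup>2 * (b powr (q - 2) / (q - 2)))"
      using q2 by (subst ennreal_mult[symmetric]) auto
    also have "w\<^sup>2 * (b powr (q - 2) / (q - 2)) = 2 powr (q - 2) / (q - 2) * w powr p"
    proof -
      have e: "(1 - p) * (q - 2) = p - 2" using p by (simp add: q field_simps)
      have "b powr (q - 2) = 2 powr (q - 2) * w powr (p - 2)"
        unfolding b_def using w by (simp add: powr_mult powr_powr e)
      moreover have "w\<^sup>2 * w powr (p - 2) = w powr p"
        using w by (simp add: powr_diff)
      ultimately show ?thesis by (simp add: field_simps)
    qed
    finally show ?thesis by (simp add: w_def)
  qed (simp add: sm_def)
  have "(\<integral>\<^sup>+x. indicator ?I x * ennreal (norm (trig_sum F \<phi> x) powr q) \<partial>lborel)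
     \<le> (\<integral>\<^sup>+x. indicator ?I x * (\<integral>\<^sup>+l. indicator {0..} l * ennreal (h l x) \<partial>lborel) \<partial>lborel)"
    by (intro nn_integral_mono mult_left_mono pt) simp
  also have "\<dots> = (\<integral>\<^sup>+x. \<integral>\<^sup>+l. indicator ?I x * (indicator {0..} l * ennreal (h l x)) \<partial>lborel \<partial>lborel)"
    by (intro nn_integral_cong nn_integral_cmult[symmetric]) measurable
  also have "\<dots> = (\<integral>\<^sup>+l. \<integral>\<^sup>+x. indicator ?I x * (indicator {0..} l * ennreal (h l x)) \<partial>lborel \<partial>lborel)"
    by (rule lborel_pair.Fubini') measurable
  also have "\<dots> = (\<integral>\<^sup>+l. indicator {0..} l * (\<integral>\<^sup>+x. indicator ?I x * ennreal (h l x) \<partial>lborel) \<partial>lborel)"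
    by (subst nn_integral_cmult[symmetric]) (auto simp: mult_ac intro!: nn_integral_cong)
  also have "\<dots> = (\<integral>\<^sup>+l. ennreal (8 * q * R) *
      (\<Sum>n\<in>F. indicator {0..} l * ennreal (l powr (q - 3) * (norm (sm l n))\<^sup>2)) \<partial>lborel)"
    unfolding inner by (intro nn_integral_cong) (simp add: sum_distrib_left mult_ac del: sum_ennreal)
  also have "\<dots> = ennreal (8 * q * R) * (\<Sum>n\<in>F. ennreal (2 powr (q - 2) / (q - 2) * norm (\<phi> n) powr p))"
  proof -
    have [measurable]: "(\<lambda>l. sm l n) \<in> borel_measurable borel" for n
      unfolding sm_def by measurable
    show ?thesis
      by (subst nn_integral_cmult, measurable, subst nn_integral_sum) (auto simp: layer)
  qed
  also have "(\<Sum>n\<in>F. ennreal (2 powr (q - 2) / (q - 2) * norm (\<phi> n) powr p))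
      = ennreal (2 powr (q - 2) / (q - 2) * (\<Sum>n\<in>F. norm (\<phi> n) powr p))"
    unfolding sum_distrib_left using q2 by (intro sum_ennreal) auto
  also have "ennreal (8 * q * R) * \<dots> = ennreal (hy_const q * R * (\<Sum>n\<in>F. norm (\<phi> n) powr p))"
    using q2 by (subst ennreal_mult[symmetric]) (auto simp: hy_const_def mult_ac intro!: sum_nonneg mult_nonneg_nonneg divide_nonneg_nonneg)
  also have "\<dots> \<le> ennreal (hy_const q * R * 1)"
    using le1 q2 by (intro ennreal_leI mult_left_mono) (auto simp: hy_const_def)
  finally show ?thesis by simp
qed

text \<open>The bound that Young's inequality gives for normalized \<open>S\<close> and
  \<open>\<phi>\<close>: \<open>1 / p\<close> from the p-th power of \<open>S\<close>, and the
  Hausdorff-Young bound divided by the conjugate exponent.\<close>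

definition pairing_const :: "real \<Rightarrow> nat \<Rightarrow> real" where
  "pairing_const p R = 1 / p + hy_const (p / (p - 1)) * R / (p / (p - 1))"

lemma pairing_const_nonneg: "1 < p \<Longrightarrow> p < 2 \<Longrightarrow> 0 \<le> pairing_const p R"
proof -
  assume p: "1 < p" "p < 2"
  then have "2 < p / (p - 1)" by (simp add: field_simps)
  with p show ?thesis unfolding pairing_const_def hy_const_def
    by (intro add_nonneg_nonneg mult_nonneg_nonneg divide_nonneg_nonneg) auto
qed

lemma trig_sum_scale: "trig_sum F (\<lambda>n. c * \<phi> n) x = c * trig_sum F \<phi> x"
  by (simp add: trig_sum_def sum_distrib_left mult_ac)

text \<open>Hoelder's inequality, obtained from Young's inequality after scaling both norms to 1.
  The support of \<open>S\<close> enters here: it confines the q-th power of the trigonometric sum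
  to an interval where Hausdorff-Young applies.\<close>

lemma hausdorff_young_pairing:
  fixes R :: nat
  assumes p: "1 < p" "p < 2" and F: "finite F" and [measurable]: "S \<in> borel_measurable borel"
    and S: "integrable lborel (\<lambda>x. norm (S x) powr p)"
    and supp: "AE x in lborel. x \<notin> {-real R..real R} \<longrightarrow> S x = 0"
  shows "integrable lborel (\<lambda>x. S x * trig_sum F \<phi> x)"
    and "(LINT x|lborel. norm (S x * trig_sum F \<phi> x)) \<le>
      pairing_const p R * (\<Sum>n\<in>F. norm (\<phi> n) powr p) powr (1 / p) * (LINT x|lborel. norm (S x) powr p) powr (1 / p)"
proof -
  define q where "q = p / (p - 1)"
  have q2: "q > 2" and pq: "1 / p + 1 / q = 1" using p by (simp_all add: q_def field_simps)
  let ?I = "{-real R..real R}"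
  define D where "D = pairing_const p R"
  define s where "s = (LINT x|lborel. norm (S x) powr p) powr (1 / p)"
  define t where "t = (\<Sum>n\<in>F. norm (\<phi> n) powr p) powr (1 / p)"
  have D0: "0 \<le> D" unfolding D_def using p by (rule pairing_const_nonneg)
  have s0: "0 \<le> s" and t0: "0 \<le> t" by (simp_all add: s_def t_def)
  have expand: "ennreal (a * (b * c + d * e)) = ennreal a * (ennreal b * ennreal c + ennreal d * ennreal e)"
    if "0 \<le> a" "0 \<le> b" "0 \<le> c" "0 \<le> d" "0 \<le> e" for a b c d e :: real
    using that by (simp add: ennreal_mult)
  have "(\<integral>\<^sup>+x. ennreal (norm (S x * trig_sum F \<phi> x)) \<partial>lborel) \<le> ennreal (D * t * s)"
  \<comment> \<open>Scaling would divide by \<open>s\<close> and \<open>t\<close>. If either is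
    zero, the product vanishes almost everywhere.\<close>
  proof (cases "s = 0 \<or> t = 0")
    case True
    have "AE x in lborel. S x * trig_sum F \<phi> x = 0"
    proof (cases "s = 0")
      case True
      then have "(LINT x|lborel. norm (S x) powr p) = 0" by (simp add: s_def)
      then have "AE x in lborel. norm (S x) powr p = 0"
        using integral_nonneg_eq_0_iff_AE[OF S] by simp
      then show ?thesis by eventually_elim simp
    next
      case False
      then have "(\<Sum>n\<in>F. norm (\<phi> n) powr p) = 0" using True by (simp add: t_def)
      then have "\<forall>n\<in>F. \<phi> n = 0" using F by (subst (asm) sum_nonneg_eq_0_iff) auto
      then show ?thesis by (simp add: trig_sum_def)
    qed
    then have "(\<integral>\<^sup>+x. ennreal (norm (S x * trig_sum F \<phi> x)) \<partial>lborel) = 0"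
      by (subst nn_integral_0_iff_AE) auto
    then show ?thesis by simp
  next
    case False
    then have s: "0 < s" and t: "0 < t" using s0 t0 by auto
    have sp: "s powr p = (LINT x|lborel. norm (S x) powr p)"
      unfolding s_def using p by (simp add: powr_powr)
    have tp: "t powr p = (\<Sum>n\<in>F. norm (\<phi> n) powr p)"
      unfolding t_def using p by (simp add: powr_powr sum_nonneg)
    define \<psi> where "\<psi> n = of_real (inverse t) * \<phi> n" for n
    have "(\<Sum>n\<in>F. norm (\<psi> n) powr p) = inverse t powr p * (\<Sum>n\<in>F. norm (\<phi> n) powr p)"
      unfolding \<psi>_def sum_distrib_left using t by (intro sum.cong) (auto simp: norm_mult powr_mult norm_inverse)
    also have "\<dots> = 1" unfolding tp[symmetric] using t by (simp add: powr_mult[symmetric])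
    finally have \<psi>1: "(\<Sum>n\<in>F. norm (\<psi> n) powr p) \<le> 1" by simp
    have T: "trig_sum F \<phi> x = of_real t * trig_sum F \<psi> x" for x
      unfolding \<psi>_def trig_sum_scale using t by simp
    have Sint: "(\<integral>\<^sup>+x. ennreal (norm (S x) powr p / s powr p) \<partial>lborel) = 1"
    proof -
      have "(\<integral>\<^sup>+x. ennreal (norm (S x) powr p / s powr p) \<partial>lborel) = ennreal (LINT x|lborel. norm (S x) powr p / s powr p)"
        using S by (intro nn_integral_eq_integral) auto
      then show ?thesis using s by (simp add: sp[symmetric])
    qed
    have "(\<integral>\<^sup>+x. ennreal (norm (S x * trig_sum F \<phi> x)) \<partial>lborel) \<le>
      (\<integral>\<^sup>+x. ennreal (s * t) * (ennreal (1 / p) * ennreal (norm (S x) powr p / s powr p)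
         + ennreal (1 / q) * (indicator ?I x * ennreal (norm (trig_sum F \<psi> x) powr q))) \<partial>lborel)"
    proof (rule nn_integral_mono_AE)
      show "AE x in lborel. ennreal (norm (S x * trig_sum F \<phi> x)) \<le>
        ennreal (s * t) * (ennreal (1 / p) * ennreal (norm (S x) powr p / s powr p)
         + ennreal (1 / q) * (indicator ?I x * ennreal (norm (trig_sum F \<psi> x) powr q)))"
        using supp
      proof eventually_elim
        case (elim x)
        show ?case
        proof (cases "x \<in> ?I")
          case True
          have "norm (S x) / s * norm (trig_sum F \<psi> x) \<le>
              (norm (S x) / s) powr p / p + norm (trig_sum F \<psi> x) powr q / q"
            using p q2 pq s by (intro Youngs_inequality) auto
          also have "(norm (S x) / s) powr p = norm (S x) powr p / s powr p"
            using s by (simp add: powr_divide)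
          finally have "s * t * (norm (S x) / s * norm (trig_sum F \<psi> x)) \<le>
              s * t * (1 / p * (norm (S x) powr p / s powr p) + 1 / q * norm (trig_sum F \<psi> x) powr q)"
            using s t by (intro mult_left_mono) (simp_all add: mult.commute)
          moreover have "s * t * (norm (S x) / s * norm (trig_sum F \<psi> x)) = norm (S x * trig_sum F \<phi> x)"
            using s t by (simp add: T norm_mult)
          ultimately have "ennreal (norm (S x * trig_sum F \<phi> x)) \<le>
              ennreal (s * t * (1 / p * (norm (S x) powr p / s powr p) + 1 / q * norm (trig_sum F \<psi> x) powr q))"
            by (intro ennreal_leI) simp
          also have "\<dots> = ennreal (s * t) * (ennreal (1 / p) * ennreal (norm (S x) powr p / s powr p)
               + ennreal (1 / q) * ennreal (norm (trig_sum F \<psi> x) powr q))"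
            using s t p q2 by (intro expand) auto
          finally show ?thesis using True by simp
        qed (use elim in auto)
      qed
    qed
    also have "\<dots> = ennreal (s * t) * (ennreal (1 / p) * 1
         + ennreal (1 / q) * (\<integral>\<^sup>+x. indicator ?I x * ennreal (norm (trig_sum F \<psi> x) powr q) \<partial>lborel))"
      by (simp add: nn_integral_cmult nn_integral_add Sint)
    also have "\<dots> \<le> ennreal (s * t) * (ennreal (1 / p) * 1 + ennreal (1 / q) * ennreal (hy_const q * R))"
      by (intro mult_left_mono add_left_mono hausdorff_young_normalized[OF p q_def F \<psi>1]) auto
    also have "\<dots> = ennreal (D * t * s)"
    proof -
      have "0 \<le> hy_const q" using q2 by (simp add: hy_const_def)
      then have "ennreal (1 / p) * 1 + ennreal (1 / q) * ennreal (hy_const q * R) = ennreal (1 / p + 1 / q * (hy_const q * R))"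
        using p q2 by (subst ennreal_plus) (auto simp: ennreal_mult[symmetric])
      also have "1 / p + 1 / q * (hy_const q * R) = D" by (simp add: D_def pairing_const_def q_def)
      finally have *: "ennreal (1 / p) * 1 + ennreal (1 / q) * ennreal (hy_const q * R) = ennreal D" .
      show ?thesis unfolding * using s t D0 by (simp add: ennreal_mult[symmetric] mult_ac)
    qed
    finally show ?thesis .
  qed
  note le = this
  show int: "integrable lborel (\<lambda>x. S x * trig_sum F \<phi> x)"
    using le by (intro integrableI_bounded) (auto simp: le_less_trans[OF _ ennreal_less_top])
  have "ennreal (LINT x|lborel. norm (S x * trig_sum F \<phi> x)) \<le> ennreal (D * t * s)"
    using le int by (subst nn_integral_eq_integral[symmetric]) auto
  then show "(LINT x|lborel. norm (S x * trig_sum F \<phi> x)) \<le> D * t * s"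
    using D0 s0 t0 by (subst (asm) ennreal_le_iff) auto
qed

section \<open>The kernel of the multiplier\<close>

text \<open>The complement of the support is a union of possibly uncountably many open sets.
  Lindelof's theorem extracts a countable subfamily with the same union, so only countably many null
  sets have to be joined.\<close>

lemma AE_zero_outside_ess_support: "AE x in lebesgue. x \<notin> ess_support f \<longrightarrow> f x = 0"
proof -
  define \<U> where "\<U> = {U. open U \<and> (AE x in lebesgue. x \<in> U \<longrightarrow> f x = 0)}"
  obtain \<V> where V: "\<V> \<subseteq> \<U>" "countable \<V>" "\<Union>\<V> = \<Union>\<U>"
    using Lindelof_openin[of \<U> UNIV] by (auto simp: \<U>_def)
  have "AE x in lebesgue. \<forall>U\<in>\<V>. x \<in> U \<longrightarrow> f x = 0"
    using V by (subst AE_ball_countable) (auto simp: \<U>_def)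
  then show ?thesis
  proof eventually_elim
    case (elim x)
    then show ?case using V(3) by (auto simp: ess_support_def \<U>_def[symmetric])
  qed
qed

section \<open>Finite partial sums over the integers\<close>

lemma sum_le_integral_count_space:
  fixes a :: "'b \<Rightarrow> real"
  assumes a: "integrable (count_space UNIV) a" "\<And>x. 0 \<le> a x" and F: "finite F"
  shows "(\<Sum>x\<in>F. a x) \<le> (LINT x|count_space UNIV. a x)"
proof -
  have "(\<Sum>x\<in>F. a x) = (LINT x|count_space UNIV. indicator F x * a x)"
    using F by (subst lebesgue_integral_count_space_finite_support)
      (auto intro!: sum.mono_neutral_cong_right simp: indicator_def)
  also have "\<dots> \<le> (LINT x|count_space UNIV. a x)"
    using a(2)
    by (intro integral_mono a(1) Bochner_Integration.integrable_bound[OF a(1)]) (auto simp: indicator_def)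
  finally show ?thesis .
qed

text \<open>The limit defining \<open>W\<close> runs over the net of finite sets, while dominated
  convergence needs a sequence. Such an \<open>F\<close> serves both: it is cofinal in the net, it
  increases so that partial sums telescope, and its increments are as small as prescribed.\<close>

lemma ex_exhaustion_small_tails:
  fixes a :: "int \<Rightarrow> real" and \<epsilon> :: "nat \<Rightarrow> real"
  assumes a: "\<And>n. 0 \<le> a n" "a summable_on UNIV" and \<epsilon>: "\<And>k. 0 < \<epsilon> k"
  shows "\<exists>F. (\<forall>k. finite (F k)) \<and> mono F \<and> filterlim F (finite_subsets_at_top UNIV) sequentially \<and>
    (\<forall>k G. finite G \<and> G \<inter> F k = {} \<longrightarrow> (\<Sum>n\<in>G. a n) \<le> \<epsilon> k)"
proof -
  have "\<exists>X. finite X \<and> (\<forall>Y. finite Y \<and> X \<subseteq> Y \<longrightarrow> dist (sum a Y) (infsum a UNIV) < \<epsilon> k)" for k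
    using tendstoD[OF infsum_tendsto[OF a(2)] \<epsilon>] by (auto simp: eventually_finite_subsets_at_top)
  then obtain X where X: "\<And>k. finite (X k)" "\<And>k Y. finite Y \<Longrightarrow> X k \<subseteq> Y \<Longrightarrow> dist (sum a Y) (infsum a UNIV) < \<epsilon> k"
    by metis
  \<comment> \<open>The intervals ensure that every finite set is eventually covered, the sets
    \<open>X j\<close> make the tails small, and the union over \<open>j \<le> k\<close> makes the
    sequence increasing.\<close>
  define F where "F k = {- int k..int k} \<union> (\<Union>j\<le>k. X j)" for k
  have fin: "finite (F k)" for k unfolding F_def using X(1) by auto
  have mono: "mono F"
  proof (rule monoI)
    fix k l :: nat assume "k \<le> l"
    then have "(\<Union>j\<le>k. X j) \<subseteq> (\<Union>j\<le>l. X j)" "{- int k..int k} \<subseteq> {- int l..int l}" by force+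
    then show "F k \<subseteq> F l" unfolding F_def by blast
  qed
  have "filterlim F (finite_subsets_at_top UNIV) sequentially"
    unfolding filterlim_finite_subsets_at_top
  proof (intro allI impI)
    fix Y :: "int set" assume Y: "finite Y \<and> Y \<subseteq> UNIV"
    have "Y \<subseteq> F k" if "(\<Sum>n\<in>Y. nat \<bar>n\<bar>) \<le> k" for k
    proof
      fix n assume "n \<in> Y"
      then have "nat \<bar>n\<bar> \<le> (\<Sum>n\<in>Y. nat \<bar>n\<bar>)" using Y by (intro member_le_sum) auto
      then have "\<bar>n\<bar> \<le> int k" using that by linarith
      then show "n \<in> F k" by (auto simp: F_def)
    qed
    then show "\<forall>\<^sub>F k in sequentially. finite (F k) \<and> Y \<subseteq> F k \<and> F k \<subseteq> UNIV"
      using fin by (auto intro: eventually_sequentiallyI[of "\<Sum>n\<in>Y. nat \<bar>n\<bar>"])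
  qed
  moreover have "(\<Sum>n\<in>G. a n) \<le> \<epsilon> k" if G: "finite G" "G \<inter> F k = {}" for k G
  proof -
    have "X k \<subseteq> F k" by (auto simp: F_def)
    then have "dist (sum a (F k)) (infsum a UNIV) < \<epsilon> k" using X(2) fin by blast
    moreover have "sum a (F k) + sum a G \<le> infsum a UNIV"
      using finite_sum_le_infsum[OF a(2), of "F k \<union> G"] a(1) fin G
      by (simp add: sum.union_disjoint Int_commute)
    ultimately show ?thesis by (simp add: dist_real_def abs_if split: if_splits)
  qed
  ultimately show ?thesis using fin mono by blast
qed

text \<open>Multiplication by an exponential of integer frequency translates the Fourier transform
  by that integer. So the finite partial sums of \<open>W\<close> are Fourier transforms of
  integrable functions.\<close>

lemma fourier_mult_trig_sum:
  assumes S: "integrable lborel S" and F: "finite F"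
  shows "fourier (\<lambda>x. S x * trig_sum F \<phi> x) \<xi> = (\<Sum>n\<in>F. \<phi> n * fourier S (\<xi> - of_int n))"
proof -
  have [measurable]: "S \<in> borel_measurable borel" using S by auto
  have "S x * trig_sum F \<phi> x * cis (- (2 * pi * \<xi> * x))
      = (\<Sum>n\<in>F. \<phi> n * (S x * cis (- (2 * pi * (\<xi> - of_int n) * x))))" for x
  proof -
    have "cis (- (2 * pi * (\<xi> - of_int n) * x)) = cis (2 * pi * of_int n * x) * cis (- (2 * pi * \<xi> * x))" for n
      by (simp add: cis_mult algebra_simps)
    then show ?thesis
      by (simp add: trig_sum_def sum_distrib_left sum_distrib_right mult_ac)
  qed
  then have "fourier (\<lambda>x. S x * trig_sum F \<phi> x) \<xi>
      = (LINT x|lborel. (\<Sum>n\<in>F. \<phi> n * (S x * cis (- (2 * pi * (\<xi> - of_int n) * x)))))"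
    by (simp add: fourier_lborel)
  also have "\<dots> = (\<Sum>n\<in>F. (LINT x|lborel. \<phi> n * (S x * cis (- (2 * pi * (\<xi> - of_int n) * x)))))"
    using S by (intro Bochner_Integration.integral_sum integrable_mult_right integrable_mult_cis) auto
  finally show ?thesis by (simp add: fourier_lborel)
qed

section \<open>Construction of the integrable kernel\<close>

context
  fixes p :: real and R :: nat and S :: "real \<Rightarrow> complex"
  assumes p: "1 < p" "p < 2" and S_meas: "S \<in> borel_measurable borel"
    and S_int: "integrable lborel (\<lambda>x. norm (S x) powr p)"
    and S_supp: "AE x in lborel. x \<notin> {-real R..real R} \<longrightarrow> S x = 0"
begin

private abbreviation "B \<equiv> pairing_const p R"
private abbreviation "s \<equiv> (LINT x|lborel. norm (S x) powr p) powr (1 / p)"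

private lemma B_nonneg: "0 \<le> B" using p by (rule pairing_const_nonneg)
private lemma s_nonneg: "0 \<le> s" by simp

private lemmas pairing =
  hausdorff_young_pairing(1)[OF p _ S_meas S_int S_supp]
  hausdorff_young_pairing(2)[OF p _ S_meas S_int S_supp]

text \<open>The trigonometric sum with the single coefficient 1 at frequency 0 is the constant 1, so
  the pairing estimate contains this fact.\<close>

private lemma S_integrable: "integrable lborel S"
  using pairing(1)[of "{0}" "\<lambda>_. 1"] by (simp add: trig_sum_def)

lemma sum_norm_W_terms_le:
  assumes F: "finite F"
  shows "(\<Sum>n\<in>F. norm (\<phi> n * fourier S (\<xi> - of_int n))) \<le> B * (\<Sum>n\<in>F. norm (\<phi> n) powr p) powr (1 / p) * s"
proof -
  \<comment> \<open>Choosing the phases of the coefficients reduces absolute values to the pairing estimate.\<close>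
  define \<psi> where "\<psi> n = cnj (sgn (\<phi> n * fourier S (\<xi> - of_int n))) * \<phi> n" for n
  have \<psi>: "\<psi> n * fourier S (\<xi> - of_int n) = of_real (norm (\<phi> n * fourier S (\<xi> - of_int n)))" for n
  proof -
    have "cnj (sgn z) * z = of_real (norm z)" for z :: complex
    proof (cases "z = 0")
      case False
      have "cnj (sgn z) * z = of_real (inverse (norm z)) * (z * cnj z)"
        by (simp add: sgn_div_norm scaleR_conv_of_real)
      also have "\<dots> = of_real (inverse (norm z) * (norm z)\<^sup>2)"
        by (simp only: complex_norm_square of_real_mult)
      finally show ?thesis using False by (simp add: power2_eq_square)
    qed simp
    then show ?thesis by (simp add: \<psi>_def mult.assoc)
  qed
  have le: "norm (\<psi> n) \<le> norm (\<phi> n)" for n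
    by (simp add: \<psi>_def norm_mult norm_sgn)
  have "complex_of_real (\<Sum>n\<in>F. norm (\<phi> n * fourier S (\<xi> - of_int n))) = fourier (\<lambda>x. S x * trig_sum F \<psi> x) \<xi>"
    by (simp only: fourier_mult_trig_sum[OF S_integrable F] \<psi> of_real_sum)
  then have "(\<Sum>n\<in>F. norm (\<phi> n * fourier S (\<xi> - of_int n))) = norm (fourier (\<lambda>x. S x * trig_sum F \<psi> x) \<xi>)"
    by (subst (asm) eq_commute) (simp only: norm_of_real abs_of_nonneg sum_nonneg norm_ge_zero)
  also have "\<dots> \<le> B * (\<Sum>n\<in>F. norm (\<psi> n) powr p) powr (1 / p) * s"
    by (rule order_trans[OF norm_fourier_le[OF pairing(1)[OF F]] pairing(2)[OF F]])
  also have "\<dots> \<le> B * (\<Sum>n\<in>F. norm (\<phi> n) powr p) powr (1 / p) * s"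
    using p B_nonneg s_nonneg le
    by (intro mult_right_mono mult_left_mono powr_mono2 sum_mono) (auto intro: sum_nonneg)
  finally show ?thesis .
qed

context
  fixes \<phi> :: "int \<Rightarrow> complex" and A :: real
  assumes A: "\<And>F. finite F \<Longrightarrow> (\<Sum>n\<in>F. norm (\<phi> n) powr p) \<le> A"
begin

text \<open>The bound on finite sums of absolute values is uniform in the finite set. Without
  summability \<open>W\<close> would be the default value 0 of \<open>infsum\<close>.\<close>

lemma W_terms_summable: "(\<lambda>n. \<phi> n * fourier S (\<xi> - of_int n)) summable_on UNIV"
proof (rule abs_summable_summable, rule nonneg_bdd_above_summable_on)
  show "bdd_above (sum (\<lambda>n. norm (\<phi> n * fourier S (\<xi> - of_int n))) ` {F. F \<subseteq> UNIV \<and> finite F})"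
  proof (rule bdd_aboveI2)
    fix F :: "int set" assume "F \<in> {F. F \<subseteq> UNIV \<and> finite F}"
    then have F: "finite F" by simp
    have "B * (\<Sum>n\<in>F. norm (\<phi> n) powr p) powr (1 / p) * s \<le> B * A powr (1 / p) * s"
      using p B_nonneg s_nonneg A[OF F]
      by (intro mult_right_mono mult_left_mono powr_mono2) (auto intro: sum_nonneg)
    then show "(\<Sum>n\<in>F. norm (\<phi> n * fourier S (\<xi> - of_int n))) \<le> B * A powr (1 / p) * s"
      using sum_norm_W_terms_le[OF F] by (rule order_trans[rotated])
  qed
qed simp

text \<open>The argument of the completeness of L^1: partial sums along the exhaustion have
  increments with geometrically small L^1 norms, so they converge almost everywhere under an
  integrable majorant. Dominated convergence then yields the norm bound and the Fourier transform of
  the limit.\<close>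

lemma W_eq_fourier_integrable:
  "\<exists>K. integrable lborel K \<and> (LINT x|lborel. norm (K x)) \<le> B * A powr (1 / p) * s \<and>
    W \<phi> (fourier S) = fourier K"
proof -
  note [measurable] = S_meas
  have "(\<lambda>n. norm (\<phi> n) powr p) summable_on UNIV"
    by (rule nonneg_bdd_above_summable_on) (auto intro!: bdd_aboveI2 A)
  \<comment> \<open>The tails are bounded by a p-th power because the pairing estimate takes the
    p-th root of the sum; the increments then have L^1 norm of order
    \<open>(1/2) ^ k\<close>.\<close>
  then have "\<exists>F. (\<forall>k. finite (F k)) \<and> mono F \<and> filterlim F (finite_subsets_at_top UNIV) sequentially \<and>
      (\<forall>k G. finite G \<and> G \<inter> F k = {} \<longrightarrow> (\<Sum>n\<in>G. norm (\<phi> n) powr p) \<le> ((1/2) ^ k) powr p)"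
    by (intro ex_exhaustion_small_tails) auto
  then obtain F where F: "\<forall>k. finite (F k)" "mono F" "filterlim F (finite_subsets_at_top UNIV) sequentially"
    "\<forall>k G. finite G \<and> G \<inter> F k = {} \<longrightarrow> (\<Sum>n\<in>G. norm (\<phi> n) powr p) \<le> ((1/2) ^ k) powr p"
    by (elim exE conjE) (rule that)
  note fin = F(1)[rule_format] and mono = F(2) and lim = F(3) and tail = F(4)[rule_format, OF conjI]
  define P where "P k x = S x * trig_sum (F k) \<phi> x" for k x
  define d where "d k x = S x * trig_sum (F (Suc k) - F k) \<phi> x" for k x
  have [measurable]: "P k \<in> borel_measurable borel" "d k \<in> borel_measurable borel" for k
    unfolding P_def[abs_def] d_def[abs_def] by measurable
  have Pint: "integrable lborel (P k)" for k
    unfolding P_def by (rule pairing(1)[OF fin])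
  have dint: "integrable lborel (d k)" for k
    unfolding d_def using fin by (intro pairing(1)) auto
  have Suc: "P (Suc k) x = P k x + d k x" for k x
  proof -
    have "F k \<subseteq> F (Suc k)" using mono by (simp add: monoD)
    then have "trig_sum (F (Suc k)) \<phi> x = trig_sum (F (Suc k) - F k) \<phi> x + trig_sum (F k) \<phi> x"
      unfolding trig_sum_def using fin by (intro sum.subset_diff) auto
    then show ?thesis by (simp add: P_def d_def algebra_simps)
  qed
  have P: "P k x = P 0 x + (\<Sum>j<k. d j x)" for k x
    by (induction k) (simp_all add: Suc)
  have dle: "(LINT x|lborel. norm (d k x)) \<le> B * s * (1/2) ^ k" for k
  proof -
    have "(LINT x|lborel. norm (d k x)) \<le> B * (\<Sum>n\<in>F (Suc k) - F k. norm (\<phi> n) powr p) powr (1 / p) * s"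
      unfolding d_def using fin by (intro pairing(2)) auto
    also have "\<dots> \<le> B * (((1/2) ^ k) powr p) powr (1 / p) * s"
      using p B_nonneg s_nonneg tail[of "F (Suc k) - F k" k] fin
      by (intro mult_right_mono mult_left_mono powr_mono2) (auto intro: sum_nonneg)
    also have "(((1/2) ^ k) powr p) powr (1 / p) = (1/2::real) ^ k"
      using p by (simp add: powr_powr)
    finally show ?thesis by (simp add: mult_ac)
  qed
  have sd: "summable (\<lambda>k. LINT x|lborel. norm (d k x))"
    by (rule summable_comparison_test'[where g="\<lambda>k. B * s * (1/2) ^ k" and N=0])
       (use dle in \<open>auto intro!: summable_mult summable_geometric\<close>)
  have "(\<integral>\<^sup>+x. (\<Sum>k. ennreal (norm (d k x))) \<partial>lborel) = (\<Sum>k. ennreal (LINT x|lborel. norm (d k x)))"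
    using dint by (subst nn_integral_suminf) (auto simp: nn_integral_eq_integral)
  also have "\<dots> \<noteq> \<infinity>"
    using sd by (simp add: suminf_ennreal2)
  finally have "AE x in lborel. (\<Sum>k. ennreal (norm (d k x))) \<noteq> \<infinity>"
    by (intro nn_integral_PInf_AE) auto
  then have ae: "AE x in lborel. summable (\<lambda>k. norm (d k x))"
    by eventually_elim (auto intro: summable_suminf_not_top)
  \<comment> \<open>One majorant for all partial sums \<open>P k\<close>, integrable because the L^1
    norms of the increments are summable.\<close>
  define w where "w x = norm (P 0 x) + (\<Sum>k. norm (d k x))" for x
  have wint: "integrable lborel w"
    unfolding w_def[abs_def] using Pint dint ae sd
    by (intro Bochner_Integration.integrable_add integrable_norm integrable_suminf) auto
  define K where "K x = P 0 x + (\<Sum>k. d k x)" for x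
  have Km[measurable]: "K \<in> borel_measurable borel"
    unfolding K_def[abs_def] by measurable
  have PK: "AE x in lborel. (\<lambda>k. P k x) \<longlonglongrightarrow> K x"
    using ae
  proof eventually_elim
    case (elim x)
    then have "summable (\<lambda>k. d k x)" by (rule summable_norm_cancel)
    then have "(\<lambda>k. P 0 x + (\<Sum>j<k. d j x)) \<longlonglongrightarrow> K x"
      unfolding K_def by (intro tendsto_intros summable_LIMSEQ)
    then show ?case by (simp only: P[symmetric])
  qed
  have Pw: "AE x in lborel. norm (P k x) \<le> w x" for k
    using ae
  proof eventually_elim
    case (elim x)
    have "norm (P k x) \<le> norm (P 0 x) + (\<Sum>j<k. norm (d j x))"
      unfolding P[of k] using norm_triangle_ineq[of "P 0 x" "\<Sum>j<k. d j x"] norm_sum[of "\<lambda>j. d j x" "{..<k}"]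
      by linarith
    also have "(\<Sum>j<k. norm (d j x)) \<le> (\<Sum>j. norm (d j x))"
      using elim by (intro sum_le_suminf) auto
    finally show ?case by (simp add: w_def)
  qed
  have Kint: "integrable lborel K"
    by (rule integrable_dominated_convergence[OF _ _ wint PK Pw]) auto
  have "(\<lambda>k. LINT x|lborel. norm (P k x)) \<longlonglongrightarrow> (LINT x|lborel. norm (K x))"
  proof (rule integral_dominated_convergence[OF _ _ wint])
    show "AE x in lborel. (\<lambda>k. norm (P k x)) \<longlonglongrightarrow> norm (K x)"
      using PK by eventually_elim (rule tendsto_norm)
  qed (use Pw in auto)
  moreover have "(LINT x|lborel. norm (P k x)) \<le> B * A powr (1 / p) * s" for k
  proof -
    have "(LINT x|lborel. norm (P k x)) \<le> B * (\<Sum>n\<in>F k. norm (\<phi> n) powr p) powr (1 / p) * s"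
      unfolding P_def by (rule pairing(2)[OF fin])
    also have "\<dots> \<le> B * A powr (1 / p) * s"
      using p B_nonneg s_nonneg A[OF fin]
      by (intro mult_right_mono mult_left_mono powr_mono2) (auto intro: sum_nonneg)
    finally show ?thesis .
  qed
  ultimately have Kle: "(LINT x|lborel. norm (K x)) \<le> B * A powr (1 / p) * s"
    by (intro LIMSEQ_le_const2) auto
  \<comment> \<open>The transforms of \<open>P k\<close> have two limits:
    \<open>fourier K \<xi>\<close> by dominated convergence, and \<open>W\<close> because
    \<open>F\<close> is cofinal among the finite sets and the unordered sum converges.\<close>
  have "W \<phi> (fourier S) \<xi> = fourier K \<xi>" for \<xi>
  proof (rule LIMSEQ_unique)
    have "(\<lambda>k. LINT x|lborel. P k x * cis (- (2 * pi * \<xi> * x))) \<longlonglongrightarrow> (LINT x|lborel. K x * cis (- (2 * pi * \<xi> * x)))"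
    proof (rule integral_dominated_convergence[OF _ _ wint])
      show "AE x in lborel. (\<lambda>k. P k x * cis (- (2 * pi * \<xi> * x))) \<longlonglongrightarrow> K x * cis (- (2 * pi * \<xi> * x))"
        using PK by eventually_elim (intro tendsto_intros)
      show "AE x in lborel. norm (P k x * cis (- (2 * pi * \<xi> * x))) \<le> w x" for k
        using Pw[of k] by (simp add: norm_mult)
    qed measurable
    then show "(\<lambda>k. fourier (P k) \<xi>) \<longlonglongrightarrow> fourier K \<xi>"
      by (simp add: fourier_lborel)
    have "(\<lambda>k. \<Sum>n\<in>F k. \<phi> n * fourier S (\<xi> - of_int n)) \<longlonglongrightarrow> W \<phi> (fourier S) \<xi>"
      unfolding W_def by (rule filterlim_compose[OF infsum_tendsto[OF W_terms_summable] lim])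
    then show "(\<lambda>k. fourier (P k) \<xi>) \<longlonglongrightarrow> W \<phi> (fourier S) \<xi>"
      unfolding P_def fourier_mult_trig_sum[OF S_integrable fin] .
  qed
  then show ?thesis using Kint Kle by blast
qed

end

end

section \<open>Convolution as a Fourier multiplier\<close>

text \<open>Both \<open>K\<close> and \<open>fourier f\<close> are integrable, so Fubini allows the
  integral over \<open>\<xi>\<close> to be done first; it is the inversion integral of
  \<open>f\<close> at \<open>x - y\<close>.\<close>

lemma inv_fourier_mult_fourier:
  assumes K: "integrable lborel K" and f: "f \<in> schwartz"
  shows "inv_fourier (\<lambda>\<xi>. fourier K \<xi> * fourier f \<xi>) x = convolve K f x"
proof -
  note sf = schwartz_facts[OF f]
  have Km[measurable]: "K \<in> borel_measurable borel" using K by auto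
  note [measurable] = sf(3) fourier_measurable[OF Km] fourier_measurable[OF sf(3)]
  define H where "H \<xi> y = fourier f \<xi> * (K y * cis (2 * pi * (x - y) * \<xi>))" for \<xi> y
  have [measurable]: "(\<lambda>(\<xi>, y). H \<xi> y) \<in> borel_measurable (lborel \<Otimes>\<^sub>M lborel)"
    unfolding H_def by measurable
  have iH: "integrable (lborel \<Otimes>\<^sub>M lborel) (\<lambda>(\<xi>, y). H \<xi> y)"
  proof (rule lborel_pair.Fubini_integrable)
    show "AE \<xi> in lborel. integrable lborel (\<lambda>y. case (\<xi>, y) of (\<xi>, y) \<Rightarrow> H \<xi> y)"
      unfolding H_def prod.case using K by (intro AE_I2 integrable_mult_right integrable_mult_cis) auto
    show "integrable lborel (\<lambda>\<xi>. LINT y|lborel. norm (case (\<xi>, y) of (\<xi>, y) \<Rightarrow> H \<xi> y))"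
      using sf(5) by (simp add: H_def norm_mult)
  qed measurable
  have "inv_fourier (\<lambda>\<xi>. fourier K \<xi> * fourier f \<xi>) x = (LINT \<xi>|lborel. LINT y|lborel. H \<xi> y)"
  proof -
    have "fourier K \<xi> * fourier f \<xi> * cis (2 * pi * x * \<xi>) = (LINT y|lborel. H \<xi> y)" for \<xi>
    proof -
      have "H \<xi> y = fourier f \<xi> * cis (2 * pi * x * \<xi>) * (K y * cis (- (2 * pi * \<xi> * y)))" for y
      proof -
        have "cis (2 * pi * (x - y) * \<xi>) = cis (2 * pi * x * \<xi>) * cis (- (2 * pi * \<xi> * y))"
          by (simp add: cis_mult algebra_simps)
        then show ?thesis by (simp add: H_def)
      qed
      then show ?thesis by (simp add: fourier_lborel[OF Km])
    qed
    then show ?thesis by (subst inv_fourier_lborel) auto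
  qed
  also have "\<dots> = (LINT y|lborel. LINT \<xi>|lborel. H \<xi> y)"
    by (rule lborel_pair.Fubini_integral[OF iH, symmetric])
  also have "\<dots> = (LINT y|lborel. K y * f (x - y))"
  proof (rule Bochner_Integration.integral_cong[OF refl])
    fix y
    have "(LINT \<xi>|lborel. H \<xi> y) = (LINT \<xi>|lborel. K y * (fourier f \<xi> * cis (2 * pi * (x - y) * \<xi>)))"
      by (simp add: H_def mult_ac)
    also have "\<dots> = K y * inv_fourier (fourier f) (x - y)"
      by (simp add: inv_fourier_lborel)
    finally show "(LINT \<xi>|lborel. H \<xi> y) = K y * f (x - y)"
      using fourier_inversion[OF sf(1,2,4,5)] by simp
  qed
  finally show ?thesis by (simp add: convolve_def)
qed

lemma extends_multiplier_conv_op: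
  assumes K: "integrable lborel K"
  shows "extends_multiplier (fourier K) (conv_op K)"
  unfolding extends_multiplier_def
proof (intro ballI AE_I2)
  fix f x assume f: "f \<in> schwartz"
  have Km: "K \<in> borel_measurable borel" using K by auto
  have fm: "f \<in> borel_measurable borel" using schwartz_facts(3)[OF f] .
  \<comment> \<open>A Schwartz function is continuous, hence Borel, so it can replace the chosen
    representative of itself.\<close>
  have "conv_op K f = convolve K f"
    unfolding conv_op_def
    using borel_rep_measurable[OF borel_measurable_lebesgueI[OF fm]] borel_rep_AE[OF borel_measurable_lebesgueI[OF fm]]
    by (intro convolution_cong_AE Km fm) auto
  then show "conv_op K f x = inv_fourier (\<lambda>\<xi>. fourier K \<xi> * fourier f \<xi>) x"
    by (simp add: inv_fourier_mult_fourier[OF K f])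
qed

lemma fourier_integrable_multiplier:
  assumes q: "1 \<le> q" and K: "integrable lborel K"
  shows "fourier K \<in> fourier_multipliers q"
    and "multiplier_norm q (fourier K) \<le> (LINT x|lborel. norm (K x))"
proof -
  have Km: "K \<in> borel_measurable borel" using K by auto
  have *: "bounded_Lq_operator q (conv_op K) (LINT x|lborel. norm (K x))" "extends_multiplier (fourier K) (conv_op K)"
    using bounded_Lq_operator_conv_op[OF q K] extends_multiplier_conv_op[OF K] .
  moreover have "fourier K \<in> borel_measurable lebesgue"
    by (intro borel_measurable_lebesgueI fourier_measurable Km)
  moreover have "AE \<xi> in lebesgue. norm (fourier K \<xi>) \<le> (LINT x|lborel. norm (K x))"
    using norm_fourier_le[OF K] by simp
  ultimately show "fourier K \<in> fourier_multipliers q"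
    unfolding fourier_multipliers_def by blast
  show "multiplier_norm q (fourier K) \<le> (LINT x|lborel. norm (K x))"
    unfolding multiplier_norm_def
  proof (rule cInf_lower)
    show "bdd_below {B. \<exists>T. bounded_Lq_operator q T B \<and> extends_multiplier (fourier K) T}"
      by (rule bdd_belowI[of _ 0]) (auto simp: bounded_Lq_operator_def)
  qed (use * in blast)
qed

text \<open>A function of the set alone, so that a constant built from it depends on
  \<open>S\<close> only through the support. It is a natural number for the sake of whole
  periods.\<close>

definition radius_bound :: "real set \<Rightarrow> nat" where
  "radius_bound X = (SOME R. X \<subseteq> {-real R..real R})"

lemma subset_radius_bound:
  assumes "bounded X"
  shows "X \<subseteq> {-real (radius_bound X)..real (radius_bound X)}"
proof -
  obtain b where b: "\<And>x. x \<in> X \<Longrightarrow> norm x \<le> b" using assms by (auto simp: bounded_iff)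
  obtain R :: nat where "b \<le> real R" using real_arch_simple by blast
  then have "X \<subseteq> {-real R..real R}" using b by (force simp: abs_le_iff)
  then show ?thesis unfolding radius_bound_def by (rule someI)
qed

text \<open>\<open>C\<close> is chosen before \<open>S\<close>, \<open>\<phi>\<close> and
  \<open>q\<close> and is applied to the support, which expresses its permitted dependence.
  Summability is asserted as well, so that \<open>W\<close> is known to be a convergent sum at every
  point.\<close>

theorem proposition4p1:
  fixes p :: real
  assumes "1 < p" and "p < 2"
  shows "\<exists>C :: real set \<Rightarrow> real.
    \<forall>S \<in> Lp_space lebesgue p. compact (ess_support S) \<longrightarrow>
      (\<forall>\<phi> \<in> Lp_space (count_space UNIV) p.
        (\<forall>\<xi>. (\<lambda>n. \<phi> n * fourier S (\<xi> - of_int n)) summable_on UNIV) \<and>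
        (\<forall>q\<ge>1. W \<phi> (fourier S) \<in> fourier_multipliers q \<and>
          multiplier_norm q (W \<phi> (fourier S))
            \<le> C (ess_support S) * Lp_norm (count_space UNIV) p \<phi> * Lp_norm lebesgue p S))"
proof (intro exI[of _ "\<lambda>X. pairing_const p (radius_bound X)"] ballI impI)
  fix S :: "real \<Rightarrow> complex" and \<phi> :: "int \<Rightarrow> complex"
  assume S: "S \<in> Lp_space lebesgue p" and cpt: "compact (ess_support S)"
    and \<phi>: "\<phi> \<in> Lp_space (count_space UNIV) p"
  define R where "R = radius_bound (ess_support S)"
  \<comment> \<open>Passing to a Borel representative changes neither the Fourier transform at any
    point nor the L^p norm, and \<open>S'\<close> still vanishes almost everywhere outside the
    interval.\<close>
  define S' where "S' = borel_rep S"
  note S' = Lp_space_borel_rep[OF S, folded S'_def]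
  note [measurable] = S'(1)
  have [measurable]: "S \<in> borel_measurable lebesgue" using S by (simp add: Lp_space_def)
  have [measurable]: "S' \<in> borel_measurable lebesgue" using S'(1) by (rule borel_measurable_lebesgueI)
  have aeS: "AE x in lebesgue. S x = S' x" using S'(2) by (rule AE_completion)
  have "fourier S \<xi> = fourier S' \<xi>" for \<xi>
  proof -
    have "AE x in lebesgue. S x * cis (- (2 * pi * \<xi> * x)) = S' x * cis (- (2 * pi * \<xi> * x))"
      using aeS by eventually_elim simp
    moreover have "(\<lambda>x. cis (- (2 * pi * \<xi> * x))) \<in> borel_measurable lebesgue"
      by (rule borel_measurable_lebesgueI) simp
    ultimately show ?thesis
      unfolding fourier_cis by (intro integral_cong_AE) auto
  qed
  then have fS: "fourier S = fourier S'" by blast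
  have "AE x in lebesgue. x \<notin> {-real R..real R} \<longrightarrow> S' x = 0"
    using aeS AE_zero_outside_ess_support[of S]
  proof eventually_elim
    case (elim x)
    then show ?case
      using subset_radius_bound[OF compact_imp_bounded[OF cpt]] by (auto simp: R_def)
  qed
  then have supp: "AE x in lborel. x \<notin> {-real R..real R} \<longrightarrow> S' x = 0"
    by (simp add: AE_completion_iff)
  define A where "A = (LINT n|count_space UNIV. norm (\<phi> n) powr p)"
  have A: "(\<Sum>n\<in>F. norm (\<phi> n) powr p) \<le> A" if "finite F" for F
    unfolding A_def using \<phi> that by (intro sum_le_integral_count_space) (auto simp: Lp_space_def)
  show "(\<forall>\<xi>. (\<lambda>n. \<phi> n * fourier S (\<xi> - of_int n)) summable_on UNIV) \<and>
      (\<forall>q\<ge>1. W \<phi> (fourier S) \<in> fourier_multipliers q \<and> multiplier_norm q (W \<phi> (fourier S))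
         \<le> pairing_const p (radius_bound (ess_support S)) * Lp_norm (count_space UNIV) p \<phi> * Lp_norm lebesgue p S)"
  proof (intro conjI allI impI)
    show "(\<lambda>n. \<phi> n * fourier S (\<xi> - of_int n)) summable_on UNIV" for \<xi>
      unfolding fS using W_terms_summable[OF assms S'(1,3) supp A] .
    fix q :: real assume q: "1 \<le> q"
    obtain K where K: "integrable lborel K" "W \<phi> (fourier S) = fourier K"
      and le: "(LINT x|lborel. norm (K x)) \<le>
        pairing_const p R * A powr (1 / p) * (LINT x|lborel. norm (S' x) powr p) powr (1 / p)"
      using W_eq_fourier_integrable[OF assms S'(1,3) supp A] unfolding fS by blast
    show "W \<phi> (fourier S) \<in> fourier_multipliers q"
      unfolding K(2) by (rule fourier_integrable_multiplier[OF q K(1)])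
    show "multiplier_norm q (W \<phi> (fourier S))
         \<le> pairing_const p (radius_bound (ess_support S)) * Lp_norm (count_space UNIV) p \<phi> * Lp_norm lebesgue p S"
      unfolding K(2) using fourier_integrable_multiplier(2)[OF q K(1)] le
      by (simp add: Lp_norm_def A_def R_def S'(4))
  qed
qed

end
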